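(* Let $(G,\sigma)$ be a non-decomposable critically $3$-frustrated signed plane graph. Then $(G,\sigma)$ consists of six negative facial cycles, i.e. its facial cycles are exactly six in number and all of them are negative.
   Context: A signed graph $(G,\sigma)$ is a finite graph $G$ with a signature $\sigma:E(G)\to\{+,-\}$; a cycle is negative if it contains an odd number of negative edges. Switching at a vertex $v$ multiplies the signs of all edges incident with $v$ by $-$. The frustration index $\ell(G,\sigma)$ is the minimum number of negative edges over all signatures obtained from $\sigma$ by sequences of switchings. $(G,\sigma)$ is critically $k$-frustrated if $\ell(G,\sigma)=k$ and $\ell(G-e,\sigma)=k-1$ for every edge $e$. A critically $k$-frustrated $(G,\sigma)$ is decomposable if for some $t\ge2$ and positive integers $k_1,\dots,k_t$ with sum $k$, $E(G)$ can be partitioned into $E_1,\dots,E_t$ with each $(G[E_i],\sigma)$ critically $k_i$-frustrated; otherwise it is non-decomposable. Standing assumption: signed graphs have no loops and no two parallel edges of different signs. A signed plane graph is a signed graph with a fixed planar embedding of its underlying graph. *)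

theory Defs
  imports "HOL-Analysis.Analysis"
begin

text \<open>
  Undirected multigraphs: every edge name carries its set of end vertices, so parallel edges are
  distinct elements with the same ends. Signatures are total functions on the type of
  edge names; only their values on the edges of the graph matter.
\<close>

record ('v, 'e) multigraph =
  verts :: "'v set"
  edges :: "'e set"
  ends :: "'e \<Rightarrow> 'v set"

datatype edge_sign = Positive | Negative

primrec flip :: "edge_sign \<Rightarrow> edge_sign" where
  "flip Positive = Negative"
| "flip Negative = Positive"

definition finite_loopless_graph :: "('v, 'e) multigraph \<Rightarrow> bool" where
  "finite_loopless_graph G \<longleftrightarrow>
     finite (verts G) \<and> finite (edges G) \<and>
     (\<forall>e\<in>edges G. ends G e \<subseteq> verts G \<and> card (ends G e) = 2)"

definition signed_graph :: "('v, 'e) multigraph \<Rightarrow> ('e \<Rightarrow> edge_sign) \<Rightarrow> bool" where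
  "signed_graph G \<sigma> \<longleftrightarrow>
     finite_loopless_graph G \<and>
     (\<forall>e\<in>edges G. \<forall>f\<in>edges G. ends G e = ends G f \<longrightarrow> \<sigma> e = \<sigma> f)"

definition negative_edges :: "('v, 'e) multigraph \<Rightarrow> ('e \<Rightarrow> edge_sign) \<Rightarrow> 'e set" where
  "negative_edges G \<sigma> = {e \<in> edges G. \<sigma> e = Negative}"

definition switch :: "('v, 'e) multigraph \<Rightarrow> 'v \<Rightarrow> ('e \<Rightarrow> edge_sign) \<Rightarrow> ('e \<Rightarrow> edge_sign)" where
  "switch G v \<sigma> = (\<lambda>e. if e \<in> edges G \<and> v \<in> ends G e then flip (\<sigma> e) else \<sigma> e)"

inductive switching_reachable ::
  "('v, 'e) multigraph \<Rightarrow> ('e \<Rightarrow> edge_sign) \<Rightarrow> ('e \<Rightarrow> edge_sign) \<Rightarrow> bool"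
  for G :: "('v, 'e) multigraph" and \<sigma> :: "'e \<Rightarrow> edge_sign" where
  base: "switching_reachable G \<sigma> \<sigma>"
| step: "switching_reachable G \<sigma> \<tau> \<Longrightarrow> v \<in> verts G \<Longrightarrow> switching_reachable G \<sigma> (switch G v \<tau>)"

definition frustration_index :: "('v, 'e) multigraph \<Rightarrow> ('e \<Rightarrow> edge_sign) \<Rightarrow> nat" where
  "frustration_index G \<sigma> =
     (LEAST n. \<exists>\<tau>. switching_reachable G \<sigma> \<tau> \<and> n = card (negative_edges G \<tau>))"

definition delete_edge :: "('v, 'e) multigraph \<Rightarrow> 'e \<Rightarrow> ('v, 'e) multigraph" where
  "delete_edge G e = G\<lparr>edges := edges G - {e}\<rparr>"

definition edge_induced :: "('v, 'e) multigraph \<Rightarrow> 'e set \<Rightarrow> ('v, 'e) multigraph" where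
  "edge_induced G F = G\<lparr>verts := (\<Union>e\<in>F. ends G e), edges := F\<rparr>"

definition critically_frustrated ::
  "nat \<Rightarrow> ('v, 'e) multigraph \<Rightarrow> ('e \<Rightarrow> edge_sign) \<Rightarrow> bool" where
  "critically_frustrated k G \<sigma> \<longleftrightarrow>
     frustration_index G \<sigma> = k \<and>
     (\<forall>e\<in>edges G. int (frustration_index (delete_edge G e) \<sigma>) = int k - 1)"

definition decomposable :: "nat \<Rightarrow> ('v, 'e) multigraph \<Rightarrow> ('e \<Rightarrow> edge_sign) \<Rightarrow> bool" where
  "decomposable k G \<sigma> \<longleftrightarrow>
     (\<exists>t\<ge>2. \<exists>(K :: nat \<Rightarrow> nat) (P :: nat \<Rightarrow> 'e set).
        (\<forall>i\<in>{1..t}. 0 < K i) \<and> (\<Sum>i\<in>{1..t}. K i) = k \<and>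
        (\<Union>i\<in>{1..t}. P i) = edges G \<and> disjoint_family_on P {1..t} \<and>
        (\<forall>i\<in>{1..t}. critically_frustrated (K i) (edge_induced G (P i)) \<sigma>))"

definition non_decomposable_critically_frustrated ::
  "nat \<Rightarrow> ('v, 'e) multigraph \<Rightarrow> ('e \<Rightarrow> edge_sign) \<Rightarrow> bool" where
  "non_decomposable_critically_frustrated k G \<sigma> \<longleftrightarrow>
     critically_frustrated k G \<sigma> \<and> \<not> decomposable k G \<sigma>"

text \<open>
  Cycles are identified with their edge sets. Length two is allowed, since two
  parallel edges form a cycle.
\<close>

definition is_cycle :: "('v, 'e) multigraph \<Rightarrow> 'e set \<Rightarrow> bool" where
  "is_cycle G C \<longleftrightarrow>
     (\<exists>vs es. length es = length vs \<and> 2 \<le> length vs \<and> distinct vs \<and> distinct es \<and>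
        set vs \<subseteq> verts G \<and> set es \<subseteq> edges G \<and>
        (\<forall>i<length vs. ends G (es ! i) = {vs ! i, vs ! (Suc i mod length vs)}) \<and>
        C = set es)"

definition negative_cycle :: "('v, 'e) multigraph \<Rightarrow> ('e \<Rightarrow> edge_sign) \<Rightarrow> 'e set \<Rightarrow> bool" where
  "negative_cycle G \<sigma> C \<longleftrightarrow> is_cycle G C \<and> odd (card {e \<in> C. \<sigma> e = Negative})"

definition planar_embedding ::
  "('v, 'e) multigraph \<Rightarrow> ('v \<Rightarrow> complex) \<Rightarrow> ('e \<Rightarrow> real \<Rightarrow> complex) \<Rightarrow> bool" where
  "planar_embedding G p \<gamma> \<longleftrightarrow>
     inj_on p (verts G) \<and>
     (\<forall>e\<in>edges G. arc (\<gamma> e) \<and> {pathstart (\<gamma> e), pathfinish (\<gamma> e)} = p ` ends G e) \<and>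
     (\<forall>e\<in>edges G. \<gamma> e ` {0<..<1} \<inter> p ` verts G = {}) \<and>
     (\<forall>e\<in>edges G. \<forall>f\<in>edges G. e \<noteq> f \<longrightarrow> \<gamma> e ` {0<..<1} \<inter> path_image (\<gamma> f) = {})"

definition signed_plane_graph ::
  "('v, 'e) multigraph \<Rightarrow> ('e \<Rightarrow> edge_sign) \<Rightarrow> ('v \<Rightarrow> complex) \<Rightarrow> ('e \<Rightarrow> real \<Rightarrow> complex) \<Rightarrow> bool" where
  "signed_plane_graph G \<sigma> p \<gamma> \<longleftrightarrow> signed_graph G \<sigma> \<and> planar_embedding G p \<gamma>"

definition drawing ::
  "('v, 'e) multigraph \<Rightarrow> ('v \<Rightarrow> complex) \<Rightarrow> ('e \<Rightarrow> real \<Rightarrow> complex) \<Rightarrow> complex set" where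
  "drawing G p \<gamma> = p ` verts G \<union> (\<Union>e\<in>edges G. path_image (\<gamma> e))"

definition faces ::
  "('v, 'e) multigraph \<Rightarrow> ('v \<Rightarrow> complex) \<Rightarrow> ('e \<Rightarrow> real \<Rightarrow> complex) \<Rightarrow> complex set set" where
  "faces G p \<gamma> = components (- drawing G p \<gamma>)"

definition boundary_edges ::
  "('v, 'e) multigraph \<Rightarrow> ('e \<Rightarrow> real \<Rightarrow> complex) \<Rightarrow> complex set \<Rightarrow> 'e set" where
  "boundary_edges G \<gamma> F = {e \<in> edges G. path_image (\<gamma> e) \<subseteq> frontier F}"

text \<open>
  A facial cycle is a cycle formed by the edges on the boundary of a face. Comparing
  edge sets instead of point sets means that isolated vertices, which lie on the
  topological boundary of the face containing them, are disregarded.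
\<close>

definition facial_cycle ::
  "('v, 'e) multigraph \<Rightarrow> ('v \<Rightarrow> complex) \<Rightarrow> ('e \<Rightarrow> real \<Rightarrow> complex) \<Rightarrow> 'e set \<Rightarrow> bool" where
  "facial_cycle G p \<gamma> C \<longleftrightarrow> is_cycle G C \<and> (\<exists>F\<in>faces G p \<gamma>. C = boundary_edges G \<gamma> F)"

end

(*
  The frustration index of a plane signed graph is the minimum size of a T-join in the dual,
  where T is the set of negative faces, and critical means that every dual edge lies in a minimum
  T-join. With frustration index 3 a minimum T-join covers at most six faces, so |T| is 2, 4 or 6.
  A boundary of an odd number of negative faces meets every T-join; hence, if one such boundary
  is disjoint from further ones that have no common edge, then the graph splits into a critically
  1-frustrated and a critically 2-frustrated part. Such a configuration exists if |T| is 2 or 4.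
  If |T| = 6, then each T-join of size 3 is a perfect matching of T, so T contains both sides of
  every edge; a negative face whose boundary is not a cycle, or shared with another face, again
  yields a splitting.
*)
theory Submission
  imports Defs
begin

text \<open>The drawing may be disconnected and face boundaries need not be cycles, so the proof
  uses neither facial walks nor Euler's formula. Planarity enters through two statements: each cycle
  is the boundary of a set of faces (Jordan curve theorem), and each boundary of a set of faces
  meets every cut of \<open>G\<close> evenly (a drawn forest does not separate the plane). Together
  they identify the cycle space of \<open>G\<close> with the cut space of the dual, and this is what
  turns the sets of negative edges after switching into T-joins. Bridges are excluded beforehand:
  switching on one side of a bridge changes only the sign of that bridge, so no minimum set contains
  it.

  A splitting requires only the lower bounds 1 and 2 for the two parts. They exhaust the three
  elements of every minimum set, and a minimum set through a given edge then shows that the part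
  with this edge is critical. The bound 2 comes from odd boundaries without a common edge, since one
  edge cannot meet them all. Three face boundaries always form such a family, because an edge has
  only two sides; hence a negative face must not be nonadjacent to three others.\<close>

lemma even_card_sym_diff:
  assumes "finite A" "finite B"
  shows "even (card (sym_diff A B)) \<longleftrightarrow> (even (card A) \<longleftrightarrow> even (card B))"
proof -
  have "card (sym_diff A B) = card (A - B) + card (B - A)"
    using assms by (intro card_Un_disjoint) auto
  moreover have "card A = card (A - B) + card (A \<inter> B)" "card B = card (B - A) + card (A \<inter> B)"
    using assms by (simp_all add: card_Diff_subset_Int Int_commute card_mono)
  ultimately show ?thesis by auto
qed

section \<open>Cuts and cycles\<close>

text \<open>The edge set is a parameter of its own, so that the same notion serves subgraphs of
  \<open>G\<close> and, applied to the dual, boundaries of sets of faces.\<close>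

definition edge_cut :: "('v, 'e) multigraph \<Rightarrow> 'e set \<Rightarrow> 'v set \<Rightarrow> 'e set" where
  "edge_cut G F X = {e \<in> F. ends G e \<inter> X \<noteq> {} \<and> ends G e - X \<noteq> {}}"

text \<open>Membership in the cycle space over GF(2), written as orthogonality to all cuts.\<close>

definition even_in_cuts :: "('v, 'e) multigraph \<Rightarrow> 'e set \<Rightarrow> bool" where
  "even_in_cuts G Z \<longleftrightarrow> (\<forall>X. even (card (edge_cut G Z X)))"

definition component :: "('v, 'e) multigraph \<Rightarrow> 'e set \<Rightarrow> 'v \<Rightarrow> 'v set" where
  "component G F x = {(u, w). \<exists>f\<in>F. ends G f = {u, w}}\<^sup>* `` {x}"

lemma cut_subset: "edge_cut G F X \<subseteq> F"
  by (auto simp: edge_cut_def)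

lemma cut_iff:
  assumes "ends G e = {u, w}"
  shows "e \<in> edge_cut G F X \<longleftrightarrow> e \<in> F \<and> (u \<in> X) \<noteq> (w \<in> X)"
  using assms by (auto simp: edge_cut_def)

lemma cut_insert:
  assumes "ends G e = {u, w}"
  shows "edge_cut G (insert e F) X = (if (u \<in> X) \<noteq> (w \<in> X) then insert e (edge_cut G F X) else edge_cut G F X)"
  using assms by (auto simp: edge_cut_def)

lemma cut_mono_eq: "A \<subseteq> B \<Longrightarrow> edge_cut G A X = A \<inter> edge_cut G B X"
  by (auto simp: edge_cut_def)

lemma component_refl: "x \<in> component G F x"
  by (auto simp: component_def)

lemma component_step:
  assumes "f \<in> F" "ends G f = {u, w}"
  shows "u \<in> component G F x \<longleftrightarrow> w \<in> component G F x"
proof -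
  have "(u, w) \<in> {(u, w). \<exists>f\<in>F. ends G f = {u, w}}" "(w, u) \<in> {(u, w). \<exists>f\<in>F. ends G f = {u, w}}"
    using assms by auto
  then show ?thesis
    unfolding component_def by (meson Image_singleton_iff rtrancl.rtrancl_into_rtrancl)
qed

section \<open>Paths, and cycles opened at an edge\<close>

inductive simple_trail ::
  "('v, 'e) multigraph \<Rightarrow> 'v \<Rightarrow> 'v list \<Rightarrow> 'e list \<Rightarrow> 'v \<Rightarrow> bool" for G where
  Nil: "simple_trail G x [x] [] x"
| Cons: "ends G e = {x, z} \<Longrightarrow> simple_trail G z vs es y \<Longrightarrow> x \<notin> set vs \<Longrightarrow>
    simple_trail G x (x # vs) (e # es) y"

lemma simple_trail_basic:
  assumes "simple_trail G x vs es y"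
  shows "length vs = Suc (length es)" "distinct vs" "hd vs = x" "last vs = y" "vs \<noteq> []"
    "\<And>e. e \<in> set es \<Longrightarrow> ends G e \<subseteq> set vs" "distinct es"
    "\<And>i. i < length es \<Longrightarrow> ends G (es ! i) = {vs ! i, vs ! Suc i}"
proof -
  have "length vs = Suc (length es) \<and> distinct vs \<and> hd vs = x \<and> last vs = y \<and> vs \<noteq> [] \<and>
    (\<forall>e\<in>set es. ends G e \<subseteq> set vs) \<and> distinct es \<and>
    (\<forall>i<length es. ends G (es ! i) = {vs ! i, vs ! Suc i})"
    using assms
  proof induction
    case (Cons e x z vs es y)
    then have z: "vs ! 0 = z" "z \<in> set vs" by (auto simp: hd_conv_nth)
    have "e \<notin> set es" using Cons by auto
    then show ?case using Cons z by (auto simp: nth_Cons split: nat.splits)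
  qed auto
  then show "length vs = Suc (length es)" "distinct vs" "hd vs = x" "last vs = y" "vs \<noteq> []"
    "\<And>e. e \<in> set es \<Longrightarrow> ends G e \<subseteq> set vs" "distinct es"
    "\<And>i. i < length es \<Longrightarrow> ends G (es ! i) = {vs ! i, vs ! Suc i}"
    by auto
qed

text \<open>Serves to shorten a walk that returns to \<open>x\<close>: dropping the loop keeps the
  vertices distinct.\<close>

lemma simple_trail_suffix:
  assumes "simple_trail G z vs es y" "x \<in> set vs"
  shows "\<exists>vs' es'. simple_trail G x vs' es' y \<and> set es' \<subseteq> set es"
  using assms
proof induction
  case (Nil z)
  then show ?case by (auto intro: simple_trail.Nil)
next
  case (Cons e x' z vs es y)
  show ?case
  proof (cases "x = x'")
    case True
    then show ?thesis using simple_trail.Cons[OF Cons.hyps] by blast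
  next
    case False
    then have "x \<in> set vs" using Cons.prems by simp
    then show ?thesis using Cons.IH by (metis set_subset_Cons subset_trans)
  qed
qed

lemma simple_trail_if_component:
  assumes "y \<in> component G F x"
  shows "\<exists>vs es. simple_trail G x vs es y \<and> set es \<subseteq> F"
proof -
  have "(x, y) \<in> {(u, w). \<exists>f\<in>F. ends G f = {u, w}}\<^sup>*"
    using assms by (auto simp: component_def)
  then show ?thesis
  proof (induction rule: converse_rtrancl_induct)
    case base
    have "simple_trail G y [y] [] y" by (rule simple_trail.Nil)
    then show ?case by fastforce
  next
    case (step x z)
    then obtain f vs es where f: "f \<in> F" "ends G f = {x, z}" and
      t: "simple_trail G z vs es y" "set es \<subseteq> F" by auto
    show ?case
    proof (cases "x \<in> set vs")
      case True
      then show ?thesis using simple_trail_suffix[OF t(1)] t(2) by (meson subset_trans)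
    next
      case False
      then have "simple_trail G x (x # vs) (f # es) y" using f t by (intro simple_trail.Cons)
      moreover have "set (f # es) \<subseteq> F" using f t by auto
      ultimately show ?thesis by blast
    qed
  qed
qed

lemma simple_trail_of_lists:
  assumes "length vs = Suc (length es)" "distinct vs"
    "\<And>i. i < length es \<Longrightarrow> ends G (es ! i) = {vs ! i, vs ! Suc i}"
  shows "simple_trail G (hd vs) vs es (last vs)"
  using assms
proof (induction es arbitrary: vs)
  case Nil
  then obtain v where "vs = [v]" by (auto simp: length_Suc_conv)
  then show ?case by (auto intro: simple_trail.Nil)
next
  case (Cons e es)
  then obtain v ws where vs: "vs = v # ws" "length ws = Suc (length es)"
    by (auto simp: length_Suc_conv)
  have "ends G (es ! i) = {ws ! i, ws ! Suc i}" if "i < length es" for i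
    using Cons.prems(3)[of "Suc i"] that vs by simp
  then have "simple_trail G (hd ws) ws es (last ws)" using Cons vs by auto
  moreover have "ends G e = {v, hd ws}" using Cons.prems(3)[of 0] vs by (cases ws) auto
  moreover have "v \<notin> set ws" "hd vs = v" "last vs = last ws" using vs Cons.prems(2) by auto
  ultimately show ?case using vs(1) by (simp add: simple_trail.Cons)
qed

text \<open>Each edge of the cut changes the side of \<open>X\<close> on which the path
  runs.\<close>

lemma odd_card_cut_simple_trail:
  assumes "simple_trail G x vs es y"
  shows "odd (card (edge_cut G (set es) X)) \<longleftrightarrow> (x \<in> X) \<noteq> (y \<in> X)"
  using assms
proof induction
  case (Cons e x z vs es y)
  then have "e \<notin> set es" using simple_trail_basic(6)[OF Cons.hyps(2)] by auto
  then have "e \<notin> edge_cut G (set es) X" "finite (edge_cut G (set es) X)"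
    using cut_subset[of G "set es" X] by (auto intro: finite_subset)
  then show ?case using Cons by (auto simp: cut_insert[OF Cons.hyps(1)])
qed (simp add: edge_cut_def)

lemma is_cycle_closing_edge:
  assumes "simple_trail G x vs es y" "ends G e = {x, y}" "x \<noteq> y" "e \<notin> set es"
    and "insert e (set es) \<subseteq> edges G" "\<And>f. f \<in> edges G \<Longrightarrow> ends G f \<subseteq> verts G"
  shows "is_cycle G (insert e (set es))"
proof -
  note b = simple_trail_basic[OF assms(1)]
  have "es \<noteq> []" using assms(1,3) by (auto elim: simple_trail.cases)
  then have len: "2 \<le> length vs" using b(1) by (cases es) auto
  have "set vs \<subseteq> verts G"
  proof
    fix v assume "v \<in> set vs"
    then obtain i where i: "i < length vs" "v = vs ! i" by (auto simp: in_set_conv_nth)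
    show "v \<in> verts G"
    proof (cases "i < length es")
      case True
      then have "v \<in> ends G (es ! i)" using b(8) i by auto
      then show ?thesis using assms(5,6) True nth_mem by blast
    next
      case False
      then have "v = y" using i b(1,4,5) by (metis diff_Suc_1 last_conv_nth less_SucE)
      then show ?thesis using assms(2,5,6) by blast
    qed
  qed
  moreover have "ends G ((es @ [e]) ! i) = {vs ! i, vs ! (Suc i mod length vs)}" if "i < length vs" for i
  proof (cases "i < length es")
    case True
    then show ?thesis using b(1,8) by (simp add: nth_append)
  next
    case False
    then have i: "i = length es" using that b(1) by simp
    then have "vs ! i = y" "vs ! 0 = x"
      using b(1,3,4,5) by (auto simp: last_conv_nth hd_conv_nth)
    then show ?thesis using i b(1) assms(2) by (auto simp: nth_append)
  qed
  ultimately show ?thesis unfolding is_cycle_def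
    using b(1,2,7) len assms(4,5) by (intro exI[of _ vs] exI[of _ "es @ [e]"]) auto
qed

lemma is_cycle_open_at_edge:
  assumes "is_cycle G C" "e \<in> C"
  obtains x vs es y where "simple_trail G x vs es y" "ends G e = {x, y}" "x \<noteq> y"
    "e \<notin> set es" "C = insert e (set es)"
proof -
  obtain ws fs where l: "length fs = length ws" "2 \<le> length ws" and d: "distinct ws" "distinct fs"
    and en: "\<And>i. i < length ws \<Longrightarrow> ends G (fs ! i) = {ws ! i, ws ! (Suc i mod length ws)}"
    and C: "C = set fs"
    using assms(1) unfolding is_cycle_def by blast
  obtain k where k: "k < length ws" "e = fs ! k" using assms(2) C l by (auto simp: in_set_conv_nth)
  define n where "n = length ws"
  \<comment> \<open>Rotation by \<open>Suc k\<close> brings index \<open>k\<close> to the last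
    position, as \<open>Suc k + (n - 1) = k + n\<close>; the edges before it then form a path
    between the ends of \<open>e\<close>.\<close>
  define us gs where "us = rotate (Suc k) ws" and "gs = rotate (Suc k) fs"
  have len: "length us = n" "length gs = n" using l by (auto simp: us_def gs_def n_def)
  have us: "us ! i = ws ! ((Suc k + i) mod n)" if "i < n" for i
    using nth_rotate[of i ws "Suc k"] that by (simp add: us_def n_def)
  have gs: "gs ! i = fs ! ((Suc k + i) mod n)" if "i < n" for i
    using nth_rotate[of i fs "Suc k"] that l by (simp add: gs_def n_def)
  have n: "2 \<le> n" using l n_def by simp
  have E: "ends G (gs ! i) = {us ! i, us ! (Suc i mod n)}" if "i < n" for i
  proof -
    have "(Suc k + i) mod n < n" using n by simp
    then have "ends G (gs ! i) = {ws ! ((Suc k + i) mod n), ws ! (Suc ((Suc k + i) mod n) mod n)}"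
      using en gs[OF that] by (simp add: n_def)
    moreover have "Suc ((Suc k + i) mod n) mod n = (Suc k + (Suc i mod n)) mod n"
      by (metis add_Suc_right mod_Suc_eq mod_add_right_eq)
    ultimately show ?thesis using us[of i] us[of "Suc i mod n"] that n by simp
  qed
  have last: "gs ! (n - 1) = e"
  proof -
    have "Suc k + (n - 1) = k + n" using n by simp
    then have "(Suc k + (n - 1)) mod n = k" using k by (simp add: n_def)
    then show ?thesis using gs[of "n - 1"] n k by simp
  qed
  have gs_split: "gs = take (n - 1) gs @ [e]"
  proof -
    have "gs \<noteq> []" using len n by auto
    then have "gs = butlast gs @ [gs ! (n - 1)]" using len by (metis append_butlast_last_id last_conv_nth)
    then show ?thesis using last len by (simp add: butlast_conv_take)
  qed
  have t: "simple_trail G (hd us) us (take (n - 1) gs) (last us)"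
  proof (rule simple_trail_of_lists)
    show "length us = Suc (length (take (n - 1) gs))" using len n by simp
    show "distinct us" using d by (simp add: us_def)
    show "ends G (take (n - 1) gs ! i) = {us ! i, us ! Suc i}" if "i < length (take (n - 1) gs)" for i
      using E[of i] that len by simp
  qed
  have us_ne: "us \<noteq> []" using len n by auto
  then have hl: "hd us = us ! 0" "last us = us ! (n - 1)" using len by (auto simp: hd_conv_nth last_conv_nth)
  have ee: "ends G e = {hd us, last us}" using E[of "n - 1"] last n hl by (auto simp: insert_commute)
  have du: "distinct us" "distinct gs" using d by (auto simp: us_def gs_def)
  have ne: "hd us \<noteq> last us" using hl du n len by (simp add: nth_eq_iff_index_eq)
  have "C = set gs" using C by (simp add: gs_def)
  then have "C = insert e (set (take (n - 1) gs))" by (subst (asm) gs_split) auto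
  moreover have "e \<notin> set (take (n - 1) gs)" using du(2) by (subst (asm) gs_split) auto
  ultimately show thesis using that t ee ne by blast
qed

section \<open>Cycle space and cut space of a graph\<close>

locale loopless_graph =
  fixes G :: "('v, 'e) multigraph"
  assumes finite_loopless: "finite_loopless_graph G"
begin

lemma finite_verts: "finite (verts G)" and finite_edges: "finite (edges G)"
  and ends_in_verts: "e \<in> edges G \<Longrightarrow> ends G e \<subseteq> verts G"
  and card_ends: "e \<in> edges G \<Longrightarrow> card (ends G e) = 2"
  using finite_loopless by (auto simp: finite_loopless_graph_def)

lemma obtain_ends:
  assumes "F \<subseteq> edges G" "e \<in> F"
  obtains u w where "ends G e = {u, w}" "u \<noteq> w"
  using card_ends[OF subsetD[OF assms]] by (auto simp: card_2_iff)

lemma finite_edge_subset: "F \<subseteq> edges G \<Longrightarrow> finite F"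
  using finite_edges finite_subset by blast

lemma cut_sym_diff:
  assumes "F \<subseteq> edges G"
  shows "edge_cut G F (sym_diff X Y) = sym_diff (edge_cut G F X) (edge_cut G F Y)"
proof (rule set_eqI)
  fix e
  show "e \<in> edge_cut G F (sym_diff X Y) \<longleftrightarrow> e \<in> sym_diff (edge_cut G F X) (edge_cut G F Y)"
  proof (cases "e \<in> F")
    case True
    from True obtain u w where "ends G e = {u, w}" by (rule obtain_ends[OF assms])
    then show ?thesis by (auto simp: cut_iff)
  qed (auto simp: edge_cut_def)
qed

lemma cut_component:
  assumes "F \<subseteq> edges G"
  shows "edge_cut G F (component G F x) = {}"
proof -
  have "e \<notin> edge_cut G F (component G F x)" if e: "e \<in> F" for e
  proof -
    obtain u w where uw: "ends G e = {u, w}" by (rule obtain_ends[OF assms e])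
    then show ?thesis using component_step[OF e uw] by (simp add: cut_iff)
  qed
  then show ?thesis using cut_subset by fastforce
qed

lemma cut_component_bridge:
  assumes "F \<subseteq> edges G" "e \<in> F" "ends G e = {u, w}" "w \<notin> component G (F - {e}) u"
  shows "edge_cut G F (component G (F - {e}) u) = {e}"
proof -
  have "F = insert e (F - {e})" using assms(2) by auto
  moreover have "edge_cut G (F - {e}) (component G (F - {e}) u) = {}" using assms(1) by (intro cut_component) auto
  ultimately show ?thesis
    using cut_insert[OF assms(3), of "F - {e}" "component G (F - {e}) u"] assms(4) component_refl[of u G]
    by auto
qed

lemma cycle_through_edge:
  assumes "F \<subseteq> edges G" "e \<in> F" "ends G e = {u, w}" "w \<in> component G (F - {e}) u"
  shows "\<exists>C\<subseteq>F. e \<in> C \<and> is_cycle G C"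
proof -
  obtain vs es where t: "simple_trail G u vs es w" "set es \<subseteq> F - {e}"
    using simple_trail_if_component[OF assms(4)] by blast
  have "u \<noteq> w" using card_ends[of e] assms(1,2,3) by auto
  then have "is_cycle G (insert e (set es))"
    using t assms ends_in_verts by (intro is_cycle_closing_edge[of G u vs es w]) auto
  then show ?thesis using t assms(2) by (intro exI[of _ "insert e (set es)"]) auto
qed

lemma is_cycle_subset: "is_cycle G C \<Longrightarrow> C \<subseteq> edges G"
  by (auto simp: is_cycle_def)

lemma is_cycle_nonempty: "is_cycle G C \<Longrightarrow> C \<noteq> {}"
  by (auto simp: is_cycle_def)

lemma even_in_cuts_cycle:
  assumes "is_cycle G C"
  shows "even_in_cuts G C"
  unfolding even_in_cuts_def
proof
  fix X
  obtain e where "e \<in> C" using is_cycle_nonempty[OF assms] by blast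
  then obtain x vs es y where t: "simple_trail G x vs es y" "ends G e = {x, y}" "x \<noteq> y"
    "e \<notin> set es" "C = insert e (set es)" using is_cycle_open_at_edge[OF assms] by blast
  have "e \<notin> edge_cut G (set es) X" "finite (edge_cut G (set es) X)"
    using t(4) cut_subset[of G "set es" X] by (auto intro: finite_subset)
  then show "even (card (edge_cut G C X))"
    using odd_card_cut_simple_trail[OF t(1), of X] cut_insert[OF t(2), of "set es" X] t(5) by auto
qed

lemma even_in_cuts_sym_diff:
  assumes "A \<subseteq> edges G" "B \<subseteq> edges G" "even_in_cuts G A" "even_in_cuts G B"
  shows "even_in_cuts G (sym_diff A B)"
  unfolding even_in_cuts_def
proof
  fix X
  have "edge_cut G (sym_diff A B) X = sym_diff (edge_cut G A X) (edge_cut G B X)" by (auto simp: edge_cut_def)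
  moreover have "finite (edge_cut G A X)" "finite (edge_cut G B X)"
    using assms(1,2) finite_edge_subset cut_subset by (metis finite_subset)+
  ultimately show "even (card (edge_cut G (sym_diff A B) X))"
    using even_card_sym_diff[of "edge_cut G A X" "edge_cut G B X"] assms(3,4)
    by (simp only: even_in_cuts_def)
qed

text \<open>If \<open>e\<close> were a bridge of \<open>Z\<close>, it would form a cut of size one
  by itself.\<close>

lemma cycle_in_even_set:
  assumes "Z \<subseteq> edges G" "even_in_cuts G Z" "e \<in> Z"
  shows "\<exists>C\<subseteq>Z. e \<in> C \<and> is_cycle G C"
proof -
  obtain u w where uw: "ends G e = {u, w}" by (rule obtain_ends[OF assms(1,3)])
  have "w \<in> component G (Z - {e}) u"
  proof (rule ccontr)
    assume "w \<notin> component G (Z - {e}) u"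
    then have "card (edge_cut G Z (component G (Z - {e}) u)) = 1"
      using cut_component_bridge[OF assms(1,3) uw] by simp
    then show False using assms(2) unfolding even_in_cuts_def by (metis odd_one)
  qed
  then show ?thesis by (rule cycle_through_edge[OF assms(1,3) uw])
qed

text \<open>Cycles are peeled off: removing a cycle that meets \<open>N\<close> evenly changes
  neither the evenness in cuts nor the odd parity on \<open>N\<close>.\<close>

lemma odd_cycle_in_even_set:
  assumes "Z \<subseteq> edges G" "even_in_cuts G Z" "odd (card (Z \<inter> N))"
  shows "\<exists>C\<subseteq>Z. is_cycle G C \<and> odd (card (C \<inter> N))"
  using finite_edge_subset[OF assms(1)] assms
proof (induction Z rule: finite_psubset_induct)
  case (psubset Z)
  have "Z \<inter> N \<noteq> {}" using psubset.prems(3) by force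
  then obtain e where "e \<in> Z" by blast
  then obtain C where C: "C \<subseteq> Z" "e \<in> C" "is_cycle G C" using cycle_in_even_set[OF psubset.prems(1,2)] by blast
  show ?case
  proof (cases "odd (card (C \<inter> N))")
    case True
    then show ?thesis using C by blast
  next
    case False
    have "sym_diff Z C = Z - C" using C by auto
    then have "even_in_cuts G (Z - C)"
      using even_in_cuts_sym_diff[of Z C] psubset.prems(1,2) C even_in_cuts_cycle[OF C(3)] by auto
    moreover have "card (Z \<inter> N) = card (C \<inter> N) + card ((Z - C) \<inter> N)"
      using C psubset.hyps by (subst card_Un_disjoint[symmetric]) (auto intro: finite_subset arg_cong[of _ _ card])
    ultimately have "\<exists>C'\<subseteq>Z - C. is_cycle G C' \<and> odd (card (C' \<inter> N))"
      using C False psubset.prems(1,3) by (intro psubset.IH) auto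
    then show ?thesis by blast
  qed
qed

text \<open>A set orthogonal to all cycles belongs to the cut space. Edges are added one at a time.
  If the new edge \<open>e\<close> closes a cycle, parity on this cycle forces \<open>X\<close> to
  be right at \<open>e\<close>; if \<open>e\<close> is a bridge, toggling \<open>X\<close> on the
  component of \<open>u\<close> corrects \<open>e\<close> and affects no other edge.\<close>

lemma cut_if_even_on_cycles:
  assumes "F \<subseteq> edges G" "D \<subseteq> F" "\<And>C. C \<subseteq> F \<Longrightarrow> is_cycle G C \<Longrightarrow> even (card (C \<inter> D))"
  shows "\<exists>X. D = edge_cut G F X"
  using finite_edge_subset[OF assms(1)] assms
proof (induction F arbitrary: D rule: finite_induct)
  case empty
  then show ?case by (auto simp: edge_cut_def)
next
  case (insert e F)
  have "even (card (C \<inter> (D - {e})))" if "C \<subseteq> F" "is_cycle G C" for C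
  proof -
    have "C \<inter> (D - {e}) = C \<inter> D" using that insert.hyps by auto
    then show ?thesis using insert.prems(3)[of C] that by auto
  qed
  then obtain X where X: "D - {e} = edge_cut G F X" using insert.IH[of "D - {e}"] insert.prems by auto
  obtain u w where uw: "ends G e = {u, w}" by (rule obtain_ends[OF insert.prems(1) insertI1])
  show ?case
  proof (cases "e \<in> D \<longleftrightarrow> (u \<in> X) \<noteq> (w \<in> X)")
    case True
    then have "D = edge_cut G (insert e F) X" using X insert.hyps by (auto simp: cut_insert[OF uw])
    then show ?thesis by blast
  next
    case False
    have Fe: "insert e F - {e} = F" using insert.hyps by auto
    show ?thesis
    proof (cases "w \<in> component G F u")
      case True
      then obtain C where C: "C \<subseteq> insert e F" "e \<in> C" "is_cycle G C"
        using cycle_through_edge[of "insert e F" e u w] insert.prems uw Fe by auto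
      have "C \<inter> D = sym_diff (edge_cut G C X) {e}"
      proof -
        have "edge_cut G C X = C \<inter> edge_cut G (insert e F) X" using C by (intro cut_mono_eq)
        then show ?thesis using X False C insert.hyps by (auto simp: cut_insert[OF uw])
      qed
      moreover have "finite (edge_cut G C X)" using C insert.hyps cut_subset by (metis finite.insertI finite_subset)
      ultimately have "odd (card (C \<inter> D))"
        using even_card_sym_diff[of "edge_cut G C X" "{e}"] even_in_cuts_cycle[OF C(3)]
        by (simp add: even_in_cuts_def)
      then show ?thesis using insert.prems(3) C by blast
    next
      case nc: False
      let ?Y = "component G F u"
      have "edge_cut G (insert e F) (sym_diff X ?Y) = sym_diff (edge_cut G (insert e F) X) {e}"
        using cut_sym_diff[OF insert.prems(1)] cut_component_bridge[of "insert e F" e u w] insert.prems uw nc Fe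
        by auto
      also have "\<dots> = D" using X False insert.hyps by (auto simp: cut_insert[OF uw])
      finally show ?thesis by blast
    qed
  qed
qed

end

section \<open>The dual of a plane graph\<close>

locale plane_graph = loopless_graph G
  for G :: "('v, 'e) multigraph" +
  fixes p :: "'v \<Rightarrow> complex" and \<gamma> :: "'e \<Rightarrow> real \<Rightarrow> complex"
  assumes embedding: "planar_embedding G p \<gamma>"
begin

text \<open>All vertices stay, whatever \<open>F\<close> is, so that deleting an edge removes
  exactly its open arc.\<close>

definition partial_drawing :: "'e set \<Rightarrow> complex set" where
  "partial_drawing F = p ` verts G \<union> (\<Union>e\<in>F. path_image (\<gamma> e))"

definition curve :: "'e set \<Rightarrow> complex set" where
  "curve F = (\<Union>e\<in>F. path_image (\<gamma> e))"

definition open_arc :: "'e \<Rightarrow> complex set" where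
  "open_arc e = \<gamma> e ` {0<..<1}"

definition sides :: "'e \<Rightarrow> complex set set" where
  "sides e = {F \<in> faces G p \<gamma>. path_image (\<gamma> e) \<subseteq> frontier F}"

text \<open>
  A cut of the dual, \<open>edge_cut dual (edges G) S\<close>, is the boundary of the set S of faces.
\<close>

definition dual :: "(complex set, 'e) multigraph" where
  "dual = \<lparr>verts = (\<Union>e\<in>edges G. sides e), edges = edges G, ends = sides\<rparr>"

lemma inj_on_p: "inj_on p (verts G)"
  and arc_edge: "e \<in> edges G \<Longrightarrow> arc (\<gamma> e)"
  and ends_edge: "e \<in> edges G \<Longrightarrow> {pathstart (\<gamma> e), pathfinish (\<gamma> e)} = p ` ends G e"
  and open_arc_verts: "e \<in> edges G \<Longrightarrow> open_arc e \<inter> p ` verts G = {}"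
  and open_arc_path_image:
    "e \<in> edges G \<Longrightarrow> f \<in> edges G \<Longrightarrow> e \<noteq> f \<Longrightarrow> open_arc e \<inter> path_image (\<gamma> f) = {}"
  using embedding by (simp_all add: planar_embedding_def open_arc_def)

lemma path_image_eq:
  assumes "e \<in> edges G"
  shows "path_image (\<gamma> e) = open_arc e \<union> p ` ends G e"
proof -
  have "{0..1::real} = {0<..<1} \<union> {0, 1}" by auto
  then have "path_image (\<gamma> e) = open_arc e \<union> {pathstart (\<gamma> e), pathfinish (\<gamma> e)}"
    unfolding path_image_def open_arc_def pathstart_def pathfinish_def by auto
  then show ?thesis using ends_edge[OF assms] by simp
qed

lemma p_in_path_image_iff:
  assumes "e \<in> edges G" "v \<in> verts G"
  shows "p v \<in> path_image (\<gamma> e) \<longleftrightarrow> v \<in> ends G e"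
proof -
  have "p v \<notin> open_arc e" using open_arc_verts[OF assms(1)] assms(2) by blast
  moreover have "p v \<in> p ` ends G e \<longleftrightarrow> v \<in> ends G e"
    using inj_on_image_mem_iff[OF inj_on_p assms(2) ends_in_verts[OF assms(1)]] .
  ultimately show ?thesis using path_image_eq[OF assms(1)] by blast
qed

lemma path_image_Int:
  assumes "e \<in> edges G" "f \<in> edges G" "e \<noteq> f"
  shows "path_image (\<gamma> e) \<inter> path_image (\<gamma> f) \<subseteq> p ` (ends G e \<inter> ends G f)"
proof
  fix x assume x: "x \<in> path_image (\<gamma> e) \<inter> path_image (\<gamma> f)"
  then have "x \<notin> open_arc e" using open_arc_path_image[OF assms] by blast
  then obtain v where v: "v \<in> ends G e" "x = p v" using x path_image_eq[OF assms(1)] by blast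
  then have "v \<in> ends G f"
    using x p_in_path_image_iff[OF assms(2)] ends_in_verts[OF assms(1)] by blast
  then show "x \<in> p ` (ends G e \<inter> ends G f)" using v by blast
qed

section \<open>Point sets of edges, paths and cycles\<close>

lemma drawing_eq: "drawing G p \<gamma> = partial_drawing (edges G)"
  by (simp add: drawing_def partial_drawing_def)

lemma partial_drawing_mono: "A \<subseteq> B \<Longrightarrow> partial_drawing A \<subseteq> partial_drawing B"
  by (auto simp: partial_drawing_def)

lemma curve_subset_partial_drawing: "A \<subseteq> B \<Longrightarrow> curve A \<subseteq> partial_drawing B"
  by (auto simp: partial_drawing_def curve_def)

lemma compact_curve:
  assumes "F \<subseteq> edges G"
  shows "compact (curve F)"
  unfolding curve_def using assms finite_edge_subset[OF assms]
  by (intro compact_UN) (auto intro: compact_arc_image arc_edge)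

lemma compact_partial_drawing:
  assumes "F \<subseteq> edges G"
  shows "compact (partial_drawing F)"
  using compact_curve[OF assms] finite_verts unfolding partial_drawing_def curve_def
  by (intro compact_Un) (auto intro: finite_imp_compact)

lemma open_arc_partial_drawing:
  assumes "e \<in> edges G" "F \<subseteq> edges G" "e \<notin> F"
  shows "open_arc e \<inter> partial_drawing F = {}"
  unfolding partial_drawing_def
  using open_arc_verts[OF assms(1)] open_arc_path_image[OF assms(1)] assms(2,3) by blast

lemma partial_drawing_Int_path_image:
  assumes "e \<in> edges G" "F \<subseteq> edges G" "e \<notin> F"
  shows "partial_drawing F \<inter> path_image (\<gamma> e) = p ` ends G e"
proof -
  have "p ` ends G e \<subseteq> partial_drawing F"
    using ends_in_verts[OF assms(1)] by (auto simp: partial_drawing_def)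
  then show ?thesis using open_arc_partial_drawing[OF assms] path_image_eq[OF assms(1)] by blast
qed

lemma connected_open_arc:
  assumes "e \<in> edges G"
  shows "connected (open_arc e)"
proof -
  have "continuous_on {0<..<1} (\<gamma> e)"
    using arc_imp_path[OF arc_edge[OF assms]] by (auto simp: path_def intro: continuous_on_subset)
  then show ?thesis unfolding open_arc_def by (intro connected_continuous_image) auto
qed

lemma open_arc_nonempty: "open_arc e \<noteq> {}"
  by (auto simp: open_arc_def)

lemma path_image_subset_if_open_arc:
  assumes "e \<in> edges G" "open_arc e \<subseteq> T" "closed T"
  shows "path_image (\<gamma> e) \<subseteq> T"
proof -
  have "continuous_on (closure {0<..<1}) (\<gamma> e)"
    using arc_imp_path[OF arc_edge[OF assms(1)]] by (simp add: path_def)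
  then have "\<gamma> e ` closure {0<..<1} \<subseteq> T"
    using assms(2,3) unfolding open_arc_def by (intro image_closure_subset) auto
  then show ?thesis by (simp add: path_image_def)
qed

lemma oriented_arc:
  assumes "e \<in> edges G" "ends G e = {x, y}"
  shows "\<exists>g. arc g \<and> path_image g = path_image (\<gamma> e) \<and> pathstart g = p x \<and> pathfinish g = p y"
proof -
  have "{pathstart (\<gamma> e), pathfinish (\<gamma> e)} = {p x, p y}" using ends_edge[OF assms(1)] assms(2) by simp
  then consider "pathstart (\<gamma> e) = p x" "pathfinish (\<gamma> e) = p y"
    | "pathstart (\<gamma> e) = p y" "pathfinish (\<gamma> e) = p x"
    by (auto simp: doubleton_eq_iff)
  then show ?thesis
  proof cases
    case 1
    then show ?thesis using arc_edge[OF assms(1)] by blast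
  next
    case 2
    then show ?thesis using arc_edge[OF assms(1)]
      by (intro exI[of _ "reversepath (\<gamma> e)"]) (simp add: arc_reversepath)
  qed
qed

lemma arc_of_simple_trail:
  assumes "simple_trail G x vs es y" "es \<noteq> []" "set es \<subseteq> edges G"
  shows "\<exists>g. arc g \<and> path_image g = curve (set es) \<and> pathstart g = p x \<and> pathfinish g = p y"
  using assms
proof induction
  case (Cons e x z vs es y)
  have e: "e \<in> edges G" using Cons.prems by simp
  obtain g where g: "arc g" "path_image g = path_image (\<gamma> e)" "pathstart g = p x" "pathfinish g = p z"
    using oriented_arc[OF e Cons.hyps(1)] by blast
  show ?case
  proof (cases "es = []")
    case True
    then have "y = z" using Cons.hyps(2) by (auto elim: simple_trail.cases)
    then show ?thesis using g True by (auto simp: curve_def)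
  next
    case False
    then obtain h where h: "arc h" "path_image h = curve (set es)" "pathstart h = p z" "pathfinish h = p y"
      using Cons by auto
    have "path_image (\<gamma> e) \<inter> path_image (\<gamma> f) \<subseteq> {p z}" if f: "f \<in> set es" for f
    proof -
      have "x \<notin> ends G f" using simple_trail_basic(6)[OF Cons.hyps(2) f] Cons.hyps(3) by blast
      then have "ends G e \<inter> ends G f \<subseteq> {z}" "e \<noteq> f" using Cons.hyps(1) by auto
      moreover have "f \<in> edges G" using f Cons.prems by auto
      ultimately show ?thesis using path_image_Int[OF e, of f] by blast
    qed
    then have "path_image g \<inter> path_image h \<subseteq> {pathstart h}" using g h by (auto simp: curve_def)
    then have "arc (g +++ h)" using g h by (intro arc_join) auto
    moreover have "path_image (g +++ h) = curve (set (e # es))"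
      using g h by (subst path_image_join) (auto simp: curve_def)
    ultimately show ?thesis using g h by (intro exI[of _ "g +++ h"]) auto
  qed
qed simp

text \<open>The last two claims prepare Janiszewski's theorem: what remains of the curve without
  \<open>e\<close> is connected and contains the ends of \<open>e\<close>.\<close>

lemma cycle_curve:
  assumes "is_cycle G C" "e \<in> C"
  shows "\<exists>c. simple_path c \<and> pathfinish c = pathstart c \<and> path_image c = curve C"
    and "connected (curve (C - {e}))" and "p ` ends G e \<subseteq> curve (C - {e})"
proof -
  obtain x vs es y where t: "simple_trail G x vs es y" "ends G e = {x, y}" "x \<noteq> y"
    "e \<notin> set es" "C = insert e (set es)" using is_cycle_open_at_edge[OF assms] by blast
  have sub: "insert e (set es) \<subseteq> edges G" using is_cycle_subset[OF assms(1)] t(5) by simp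
  have "es \<noteq> []" using t(1,3) by (auto elim: simple_trail.cases)
  then obtain g where g: "arc g" "path_image g = curve (set es)" "pathstart g = p x" "pathfinish g = p y"
    using arc_of_simple_trail[OF t(1)] sub by auto
  have "ends G e = {y, x}" using t(2) by auto
  then obtain h where h: "arc h" "path_image h = path_image (\<gamma> e)" "pathstart h = p y" "pathfinish h = p x"
    using oriented_arc[of e y x] sub by auto
  have "path_image (\<gamma> f) \<inter> path_image (\<gamma> e) \<subseteq> {p x, p y}" if "f \<in> set es" for f
  proof -
    have "f \<noteq> e" "f \<in> edges G" "e \<in> edges G" using that t(4) sub by auto
    then have "path_image (\<gamma> f) \<inter> path_image (\<gamma> e) \<subseteq> p ` (ends G f \<inter> ends G e)"
      by (intro path_image_Int)
    then show ?thesis unfolding t(2) by auto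
  qed
  then have "path_image g \<inter> path_image h \<subseteq> {pathstart g, pathstart h}"
    using g h by (auto simp: curve_def)
  then have "simple_path (g +++ h)" using g h by (intro simple_path_join_loop) auto
  moreover have "path_image (g +++ h) = curve C"
    using g h t(5) by (subst path_image_join) (auto simp: curve_def)
  ultimately show "\<exists>c. simple_path c \<and> pathfinish c = pathstart c \<and> path_image c = curve C"
    using g h by (intro exI[of _ "g +++ h"]) auto
  have C: "C - {e} = set es" using t(4,5) by auto
  show "connected (curve (C - {e}))" using g C by (metis connected_arc_image)
  show "p ` ends G e \<subseteq> curve (C - {e})"
    using g C t(2) pathstart_in_path_image[of g] pathfinish_in_path_image[of g] by auto
qed

section \<open>Cycles as Jordan curves, and the faces along an edge\<close>

lemma Jordan_cycle:
  assumes "is_cycle G C" "R = inside (curve C) \<or> R = outside (curve C)"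
  shows "open R" "connected R" "frontier R = curve C" "R \<inter> curve C = {}"
proof -
  obtain e where "e \<in> C" using is_cycle_nonempty[OF assms(1)] by blast
  then obtain c where c: "simple_path c" "pathfinish c = pathstart c" "path_image c = curve C"
    using cycle_curve(1)[OF assms(1)] by blast
  note J = Jordan_inside_outside[OF c(1,2), unfolded c(3)]
  show "open R" "connected R" "frontier R = curve C" using J assms(2) by auto
  show "R \<inter> curve C = {}" using assms(2) inside_no_overlap outside_no_overlap by metis
qed

lemma inside_outside_curve:
  "inside (curve C) \<inter> outside (curve C) = {}" "inside (curve C) \<union> outside (curve C) = - curve C"
  by (rule inside_Int_outside inside_Un_outside)+

lemma in_cycle_region:
  assumes "is_cycle G C" "R = inside (curve C) \<or> R = outside (curve C)"
    and "connected A" "A \<inter> curve C = {}" "A \<inter> R \<noteq> {}"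
  shows "A \<subseteq> R"
proof -
  have op: "open (inside (curve C))" "open (outside (curve C))"
    using Jordan_cycle(1)[OF assms(1), of "inside (curve C)"]
      Jordan_cycle(1)[OF assms(1), of "outside (curve C)"] by simp_all
  have sub: "A \<subseteq> inside (curve C) \<union> outside (curve C)"
    using inside_outside_curve(2)[of C] assms(4) by auto
  have "inside (curve C) \<inter> A = {} \<or> outside (curve C) \<inter> A = {}"
    using connectedD[OF assms(3) op _ sub] inside_outside_curve(1)[of C] by simp
  then show ?thesis using sub assms(2,5) by blast
qed

lemma face_props:
  assumes "F \<in> faces G p \<gamma>"
  shows "open F" "connected F" "F \<noteq> {}" "F \<inter> partial_drawing (edges G) = {}"
proof -
  have F: "F \<in> components (- partial_drawing (edges G))" using assms unfolding faces_def drawing_eq .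
  have "open (- partial_drawing (edges G))"
    using compact_imp_closed[OF compact_partial_drawing[OF subset_refl]] by auto
  then show "open F" using open_components F by blast
  show "connected F" "F \<noteq> {}" using in_components_connected[OF F] in_components_nonempty[OF F] by simp_all
  show "F \<inter> partial_drawing (edges G) = {}" using in_components_subset[OF F] by blast
qed

lemma face_disjoint:
  assumes "F \<in> faces G p \<gamma>" "F' \<in> faces G p \<gamma>" "F \<noteq> F'"
  shows "F \<inter> F' = {}"
  using components_nonoverlap[of F _ F'] assms unfolding faces_def by simp

text \<open>
  Removing e from the drawing merges the faces along e into one region W. As the curve of the
  cycle meets the rest of the drawing in a connected set, Janiszewski's theorem shows that
  the cycle cuts W into exactly two faces.
\<close>

lemma cycle_edge_sides:
  assumes C: "is_cycle G C" and "e \<in> C"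
  shows "\<exists>F1 F2. F1 \<subseteq> inside (curve C) \<and> F2 \<subseteq> outside (curve C) \<and> F1 \<noteq> F2 \<and>
    sides e = {F1, F2} \<and> open (F1 \<union> F2 \<union> open_arc e)"
proof -
  let ?D = "partial_drawing (edges G)" and ?K = "partial_drawing (edges G - {e})"
  have e: "e \<in> edges G" using assms is_cycle_subset by blast
  have D: "?D = ?K \<union> curve C"
    using is_cycle_subset[OF C] \<open>e \<in> C\<close> by (auto simp: partial_drawing_def curve_def)
  have comp: "compact ?K" "closed (curve C)" "closed ?D"
    using compact_partial_drawing compact_curve is_cycle_subset[OF C]
    by (auto intro: compact_imp_closed)
  have arcC: "open_arc e \<subseteq> curve C" "curve C - ?K \<subseteq> open_arc e"
  proof -
    show "open_arc e \<subseteq> curve C" using \<open>e \<in> C\<close> path_image_eq[OF e] by (auto simp: curve_def)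
    show "curve C - ?K \<subseteq> open_arc e"
    proof
      fix x assume x: "x \<in> curve C - ?K"
      then obtain f where f: "f \<in> C" "x \<in> path_image (\<gamma> f)" by (auto simp: curve_def)
      have "f = e"
      proof (rule ccontr)
        assume "f \<noteq> e"
        then have "f \<in> edges G - {e}" using f is_cycle_subset[OF C] by auto
        then have "x \<in> ?K" using f(2) by (auto simp: partial_drawing_def)
        then show False using x by simp
      qed
      moreover have "x \<notin> p ` ends G e" using x ends_in_verts[OF e] by (auto simp: partial_drawing_def)
      ultimately show "x \<in> open_arc e" using f path_image_eq[OF e] by auto
    qed
  qed
  have arcK: "open_arc e \<inter> ?K = {}" using e by (intro open_arc_partial_drawing) auto
  \<comment> \<open>The arc of \<open>e\<close> meets the remaining drawing only in its two ends,
    and the path \<open>C - {e}\<close> already contains them.\<close>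
  have KC: "?K \<inter> curve C = curve (C - {e})"
  proof -
    have "curve (C - {e}) \<subseteq> ?K \<inter> curve C"
      using is_cycle_subset[OF C] by (auto simp: partial_drawing_def curve_def)
    moreover have "curve C = curve (C - {e}) \<union> path_image (\<gamma> e)"
      using \<open>e \<in> C\<close> by (auto simp: curve_def)
    moreover have "?K \<inter> path_image (\<gamma> e) \<subseteq> curve (C - {e})"
      using partial_drawing_Int_path_image[OF e, of "edges G - {e}"] cycle_curve(3)[OF assms] by auto
    ultimately show ?thesis by blast
  qed
  obtain m where m: "m \<in> open_arc e" using open_arc_nonempty by blast
  define W where "W = connected_component_set (- ?K) m"
  have W: "open W" "connected W" "W \<subseteq> - ?K" "open_arc e \<subseteq> W"
  proof -
    show "open W" "connected W" "W \<subseteq> - ?K" unfolding W_def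
      using comp(1) by (auto intro!: open_connected_component connected_component_subset simp: compact_imp_closed open_Compl)
    show "open_arc e \<subseteq> W" unfolding W_def
      using m arcK connected_open_arc[OF e] by (intro connected_component_maximal) auto
  qed
  have Wmax: "B \<subseteq> W" if B: "connected B" "B \<subseteq> - ?K" "B \<inter> W \<noteq> {}" for B
  proof -
    obtain b where b: "b \<in> B" "b \<in> W" using B(3) by blast
    then have "connected_component_set (- ?K) b = W"
      unfolding W_def by (intro connected_component_eq)
    then show ?thesis using connected_component_maximal[OF b(1) B(1,2)] by simp
  qed
  have region: "W \<inter> R \<in> faces G p \<gamma> \<and> W \<inter> R \<in> sides e"
    if R: "R = inside (curve C) \<or> R = outside (curve C)" for R
  proof -
    note J = Jordan_cycle[OF C R]
    have arcR: "open_arc e \<subseteq> closure R" using J(3) arcC(1) closure_Un_frontier[of R] by simp blast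
    then have "W \<inter> closure R \<noteq> {}" using m W(4) by blast
    then obtain a where a: "a \<in> W \<inter> R" using open_Int_closure_eq_empty[OF W(1)] by blast
    have sub: "W \<inter> R \<subseteq> - ?D" using W(3) J(4) D by blast
    have cc: "connected_component (- ?D) x y" if "x \<in> W \<inter> R" "y \<in> W \<inter> R" for x y
      unfolding D
    proof (rule Janiszewski[OF comp(1,2)])
      show "connected (?K \<inter> curve C)" using KC cycle_curve(2)[OF assms] by simp
      show "connected_component (- ?K) x y"
        using that W unfolding connected_component_def by blast
      show "connected_component (- curve C) x y"
        using that J(2,4) unfolding connected_component_def by blast
    qed
    have WR: "W \<inter> R = connected_component_set (- ?D) a"
    proof
      show "W \<inter> R \<subseteq> connected_component_set (- ?D) a" using cc[OF a] by auto
      have aD: "a \<in> - ?D" using a sub by blast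
      define B where "B = connected_component_set (- ?D) a"
      have B: "connected B" "B \<subseteq> - ?D" "a \<in> B"
        using aD connected_component_subset[of "- ?D" a] by (auto simp: B_def)
      have "B \<subseteq> - ?K" "B \<inter> curve C = {}" using B(2) D by auto
      moreover have "B \<inter> W \<noteq> {}" "B \<inter> R \<noteq> {}" using B(3) a by auto
      ultimately have "B \<subseteq> W" "B \<subseteq> R"
        using Wmax[OF B(1)] in_cycle_region[OF C R B(1)] by simp_all
      then show "connected_component_set (- ?D) a \<subseteq> W \<inter> R" by (simp add: B_def)
    qed
    have face: "W \<inter> R \<in> faces G p \<gamma>"
    proof -
      have "a \<in> - ?D" using a sub by blast
      then show ?thesis unfolding faces_def drawing_eq WR by (rule componentsI)
    qed
    \<comment> \<open>As \<open>W\<close> is open, a point of \<open>W\<close> in the closure of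
      \<open>R\<close> is also in the closure of \<open>W \<inter> R\<close>.\<close>
    have "open_arc e \<subseteq> closure (W \<inter> R)"
      using order.trans[OF Int_greatest[OF W(4) arcR] open_Int_closure_subset[OF W(1)]] .
    then have "path_image (\<gamma> e) \<subseteq> closure (W \<inter> R)"
      by (intro path_image_subset_if_open_arc[OF e]) auto
    moreover have "path_image (\<gamma> e) \<subseteq> ?D" using e by (auto simp: partial_drawing_def)
    moreover have "open (W \<inter> R)" using W(1) J(1) by auto
    ultimately have "path_image (\<gamma> e) \<subseteq> frontier (W \<inter> R)"
      using sub unfolding frontier_def by (simp only: interior_open) blast
    then show ?thesis using face by (simp add: sides_def)
  qed
  \<comment> \<open>The point \<open>m\<close> is on the boundary of every side of \<open>e\<close>,
    so each side meets the open set \<open>W\<close> and therefore one of the two faces already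
    found.\<close>
  have only: "F = W \<inter> inside (curve C) \<or> F = W \<inter> outside (curve C)" if F: "F \<in> sides e" for F
  proof -
    have face: "F \<in> faces G p \<gamma>" and fr: "path_image (\<gamma> e) \<subseteq> frontier F"
      using F by (auto simp: sides_def)
    note fp = face_props[OF face]
    have "m \<in> closure F" using m fr path_image_eq[OF e] closure_Un_frontier[of F] by blast
    then have "W \<inter> closure F \<noteq> {}" using m W(4) by blast
    then have FW: "F \<inter> W \<noteq> {}" using open_Int_closure_eq_empty[OF W(1)] by blast
    then obtain b where b: "b \<in> F" "b \<in> W" by blast
    have "b \<in> inside (curve C) \<or> b \<in> outside (curve C)"
      using inside_outside_curve(2)[of C] b(1) fp(4) D by blast
    then obtain R where R: "R = inside (curve C) \<or> R = outside (curve C)" "b \<in> R" by blast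
    have "F = W \<inter> R"
    proof (rule ccontr)
      assume "F \<noteq> W \<inter> R"
      then have "F \<inter> (W \<inter> R) = {}" using region[OF R(1)] by (intro face_disjoint[OF face]) simp_all
      then show False using b R(2) by blast
    qed
    then show ?thesis using R(1) by blast
  qed
  let ?F1 = "W \<inter> inside (curve C)" and ?F2 = "W \<inter> outside (curve C)"
  have "sides e = {?F1, ?F2}" using region only by blast
  moreover have "?F1 \<noteq> ?F2"
    using region[of "inside (curve C)"] face_props(3)[of ?F1] inside_outside_curve(1)[of C] by blast
  \<comment> \<open>The openness obtained from this equation is what later allows faces to be glued
    together across \<open>e\<close>.\<close>
  moreover have "?F1 \<union> ?F2 \<union> open_arc e = W"
    using inside_outside_curve(2)[of C] W(3,4) arcC(2) by blast
  ultimately show ?thesis using W(1) by (intro exI[of _ ?F1] exI[of _ ?F2]) auto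
qed

text \<open>A drawn forest does not separate the plane. The new edge \<open>e\<close> joins two
  parts of the old forest: \<open>D1\<close>, drawn on the component of \<open>u\<close>, and
  \<open>D2\<close>, which contains \<open>w\<close>. The arc of \<open>e\<close> meets each of them
  in one point, so Janiszewski's theorem applies twice: first the arc is attached to
  \<open>D1\<close>, then \<open>D2\<close> is attached to their union, each time along a single
  point. The complement of the arc itself is connected.\<close>

lemma connected_complement_acyclic:
  assumes "F \<subseteq> edges G" "\<And>C. C \<subseteq> F \<Longrightarrow> \<not> is_cycle G C"
  shows "connected (- partial_drawing F)"
  using finite_edge_subset[OF assms(1)] assms
proof (induction F rule: finite_induct)
  case empty
  have "path_connected (- (p ` verts G))"
    using finite_verts by (intro path_connected_complement_countable) (auto intro: countable_finite)
  then show ?case by (simp add: partial_drawing_def path_connected_imp_connected)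
next
  case (insert e F)
  have con: "connected (- partial_drawing F)" using insert by blast
  have e: "e \<in> edges G" and F: "F \<subseteq> edges G" using insert.prems by auto
  obtain u w where uw: "ends G e = {u, w}" "u \<noteq> w"
    by (rule obtain_ends[OF insert.prems(1) insertI1])
  have Fe: "insert e F - {e} = F" using insert.hyps by auto
  define X where "X = component G F u"
  have X: "u \<in> X" "w \<notin> X"
    using cycle_through_edge[of "insert e F" e u w] insert.prems uw Fe component_refl[of u G F]
    unfolding X_def by auto
  define D1 D2 where "D1 = p ` (verts G \<inter> X) \<union> curve {f \<in> F. ends G f \<subseteq> X}"
    and "D2 = p ` (verts G - X) \<union> curve {f \<in> F. ends G f \<inter> X = {}}"
  have "ends G f \<subseteq> X \<or> ends G f \<inter> X = {}" if "f \<in> F" for f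
    using cut_component[OF F, of u] that unfolding X_def edge_cut_def by blast
  then have split: "partial_drawing F = D1 \<union> D2"
    unfolding D1_def D2_def partial_drawing_def curve_def by blast
  have disj: "D1 \<inter> D2 = {}"
  proof -
    have "p ` (verts G \<inter> X) \<inter> p ` (verts G - X) = {}"
      using inj_on_p by (auto simp: inj_on_def)
    moreover have "p ` (verts G \<inter> X) \<inter> curve {f \<in> F. ends G f \<inter> X = {}} = {}"
      using p_in_path_image_iff F by (fastforce simp: curve_def)
    moreover have "p ` (verts G - X) \<inter> curve {f \<in> F. ends G f \<subseteq> X} = {}"
      using p_in_path_image_iff F by (fastforce simp: curve_def)
    moreover have "path_image (\<gamma> f) \<inter> path_image (\<gamma> g) = {}"
      if "f \<in> F" "ends G f \<subseteq> X" "g \<in> F" "ends G g \<inter> X = {}" for f g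
    proof -
      have "ends G f \<noteq> {}" using card_ends[of f] that F by auto
      then have "f \<noteq> g" using that by auto
      then show ?thesis using path_image_Int[of f g] that F by blast
    qed
    then have "curve {f \<in> F. ends G f \<subseteq> X} \<inter> curve {f \<in> F. ends G f \<inter> X = {}} = {}"
      by (fastforce simp: curve_def)
    ultimately show ?thesis unfolding D1_def D2_def by blast
  qed
  have comp: "compact D1" "compact D2"
  proof -
    have "compact (p ` (verts G \<inter> X))" "compact (p ` (verts G - X))"
      using finite_verts by (auto intro: finite_imp_compact)
    moreover have "compact (curve {f \<in> F. ends G f \<subseteq> X})" "compact (curve {f \<in> F. ends G f \<inter> X = {}})"
      using F by (auto intro: compact_curve)
    ultimately show "compact D1" "compact D2" unfolding D1_def D2_def by (simp_all add: compact_Un)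
  qed
  let ?A = "path_image (\<gamma> e)"
  have FA: "partial_drawing F \<inter> ?A = {p u, p w}"
    using partial_drawing_Int_path_image[OF e F] insert.hyps uw by simp
  have "u \<in> verts G" "w \<in> verts G" using ends_in_verts[OF e] uw by auto
  then have pu: "p u \<in> D1" "p w \<in> D2" using X by (auto simp: D1_def D2_def)
  have out: "p u \<notin> D2" "p w \<notin> D1" using pu disj by auto
  have mem: "x \<in> ?A \<and> (x \<in> D1 \<or> x \<in> D2) \<longleftrightarrow> x = p u \<or> x = p w" for x
    using FA split by (metis Int_iff Un_iff empty_iff insert_iff)
  have A1: "D1 \<inter> ?A = {p u}"
  proof (rule set_eqI)
    show "x \<in> D1 \<inter> ?A \<longleftrightarrow> x \<in> {p u}" for x using mem[of x] out pu by (cases "x = p u"; cases "x = p w") auto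
  qed
  have "D2 \<inter> ?A = {p w}"
  proof (rule set_eqI)
    show "x \<in> D2 \<inter> ?A \<longleftrightarrow> x \<in> {p w}" for x using mem[of x] out pu by (cases "x = p u"; cases "x = p w") auto
  qed
  then have A2: "(D1 \<union> ?A) \<inter> D2 = {p w}" using disj by (simp add: Int_Un_distrib2 Int_commute[of ?A])
  have draw: "partial_drawing (insert e F) = D1 \<union> ?A \<union> D2"
    using split by (auto simp: partial_drawing_def)
  have "connected_component (- partial_drawing (insert e F)) a b"
    if ab: "a \<in> - partial_drawing (insert e F)" "b \<in> - partial_drawing (insert e F)" for a b
  proof -
    have "connected_component (- partial_drawing F) a b"
      using con[unfolded connected_iff_connected_component] ab draw split by simp
    then have cc: "connected_component (- D1) a b" "connected_component (- D2) a b"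
      using split by (auto elim: connected_component_of_subset)
    have "connected (- ?A)" using connected_arc_complement[OF arc_edge[OF e]] by simp
    then have ccA: "connected_component (- ?A) a b"
      using ab draw by (simp add: connected_iff_connected_component)
    have cA: "compact ?A" by (rule compact_arc_image[OF arc_edge[OF e]])
    have "connected (D1 \<inter> ?A)" "connected ((D1 \<union> ?A) \<inter> D2)" unfolding A1 A2 by simp_all
    note con' = this
    have "connected_component (- (D1 \<union> ?A)) a b"
      by (rule Janiszewski[OF comp(1) compact_imp_closed[OF cA] con'(1) cc(1) ccA])
    then show ?thesis unfolding draw
      by (rule Janiszewski[OF compact_Un[OF comp(1) cA] compact_imp_closed[OF comp(2)] con'(2) _ cc(2)])
  qed
  then show ?case unfolding connected_iff_connected_component by blast
qed

text \<open>\<open>T\<close> is a spanning forest, and the cycles in the second clause are its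
  fundamental cycles.\<close>

lemma maximal_acyclic_edge_set:
  "\<exists>T \<subseteq> edges G. (\<forall>C \<subseteq> T. \<not> is_cycle G C) \<and>
    (\<forall>e \<in> edges G - T. \<exists>C \<subseteq> insert e T. e \<in> C \<and> is_cycle G C)"
proof -
  define \<F> where "\<F> = {T \<in> Pow (edges G). \<forall>C\<subseteq>T. \<not> is_cycle G C}"
  have "finite \<F>" using finite_edges by (auto simp: \<F>_def)
  moreover have "{} \<in> \<F>" using is_cycle_nonempty by (auto simp: \<F>_def)
  ultimately obtain T where T: "T \<in> \<F>" "\<And>T'. T' \<in> \<F> \<Longrightarrow> T \<subseteq> T' \<Longrightarrow> T = T'"
    using finite_has_maximal[of \<F>] by blast
  have "\<exists>C \<subseteq> insert e T. e \<in> C \<and> is_cycle G C" if e: "e \<in> edges G - T" for e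
  proof (rule ccontr)
    assume no: "\<not> (\<exists>C \<subseteq> insert e T. e \<in> C \<and> is_cycle G C)"
    have "\<not> is_cycle G C" if "C \<subseteq> insert e T" for C
    proof (cases "e \<in> C")
      case False
      then have "C \<subseteq> T" using that by auto
      then show ?thesis using T(1) by (auto simp: \<F>_def)
    qed (use no that in blast)
    then have "insert e T \<in> \<F>" using e T(1) by (auto simp: \<F>_def)
    then show False using T(2)[of "insert e T"] e by blast
  qed
  then show ?thesis using T(1) by (auto simp: \<F>_def)
qed

end

section \<open>Cycles of the graph and cuts of the dual\<close>

locale bridgeless_plane_graph = plane_graph +
  assumes edge_in_cycle: "e \<in> edges G \<Longrightarrow> \<exists>C. is_cycle G C \<and> e \<in> C"
begin

lemma obtain_sides:
  assumes "e \<in> edges G"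
  obtains F1 F2 where "sides e = {F1, F2}" "F1 \<noteq> F2" "open (F1 \<union> F2 \<union> open_arc e)"
proof -
  obtain C where C: "is_cycle G C" "e \<in> C" using edge_in_cycle[OF assms] by blast
  show thesis using cycle_edge_sides[OF C] that by auto
qed

text \<open>A cycle through \<open>e\<close> separates its two sides; hence the dual has no
  loops.\<close>

lemma card_sides:
  assumes "e \<in> edges G"
  shows "card (sides e) = 2"
  by (rule obtain_sides[OF assms]) simp

lemma open_sides:
  assumes "e \<in> edges G"
  shows "open (\<Union> (sides e) \<union> open_arc e)"
  by (rule obtain_sides[OF assms]) simp

lemma sides_faces: "F \<in> sides e \<Longrightarrow> F \<in> faces G p \<gamma>"
  by (simp add: sides_def)

sublocale dual: loopless_graph dual
proof
  have "finite (sides e)" if "e \<in> edges G" for e using card_sides[OF that] card.infinite by fastforce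
  then show "finite_loopless_graph dual"
    using finite_edges card_sides by (auto simp: finite_loopless_graph_def dual_def)
qed

lemma dual_simps [simp]: "edges dual = edges G" "ends dual = sides"
  by (simp_all add: dual_def)

text \<open>The set of faces inside the curve works. An edge of \<open>C\<close> has one side inside
  and one outside. The open arc of any other edge lies in one of the two regions and draws both
  sides of the edge into that region.\<close>

lemma cycle_is_dual_cut:
  assumes C: "is_cycle G C"
  shows "\<exists>S. C = edge_cut dual (edges G) S"
proof -
  define S where "S = {F. F \<subseteq> inside (curve C)}"
  have disj: "inside (curve C) \<inter> outside (curve C) = {}" using inside_outside_curve(1)[of C] by blast
  have "e \<in> edge_cut dual (edges G) S \<longleftrightarrow> e \<in> C" if e: "e \<in> edges G" for e
  proof (cases "e \<in> C")
    case True
    then obtain F1 F2 where F: "F1 \<subseteq> inside (curve C)" "F2 \<subseteq> outside (curve C)" "sides e = {F1, F2}"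
      using cycle_edge_sides[OF C True] by auto
    \<comment> \<open>\<open>S\<close> is defined by inclusion in the inside, which would also admit
      the empty set.\<close>
    then have "F2 \<noteq> {}" using face_props(3)[of F2] sides_faces[of F2] by blast
    then have "F1 \<in> S" "F2 \<notin> S" using F(1,2) disj unfolding S_def by blast+
    then show ?thesis using True e F(3) cut_iff[of dual e F1 F2] by auto
  next
    case False
    have disjC: "open_arc e \<inter> curve C = {}"
      using open_arc_partial_drawing[OF e is_cycle_subset[OF C] False] by (auto simp: curve_def partial_drawing_def)
    obtain m where m: "m \<in> open_arc e" using open_arc_nonempty by blast
    then have "m \<in> inside (curve C) \<or> m \<in> outside (curve C)"
      using inside_outside_curve(2)[of C] disjC by blast
    then obtain R where R: "R = inside (curve C) \<or> R = outside (curve C)" "m \<in> R" by blast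
    have "F \<subseteq> R" if F: "F \<in> sides e" for F
    proof -
      note fp = face_props[OF sides_faces[OF F]]
      have "path_image (\<gamma> e) \<subseteq> frontier F" using F by (simp add: sides_def)
      then have "m \<in> closure F" using m path_image_eq[OF e] closure_Un_frontier[of F] by blast
      then have "R \<inter> closure F \<noteq> {}" using R(2) by blast
      then have "F \<inter> R \<noteq> {}" using open_Int_closure_eq_empty[OF Jordan_cycle(1)[OF C R(1)]] by blast
      moreover have "F \<inter> curve C = {}"
        using fp(4) curve_subset_partial_drawing[OF is_cycle_subset[OF C]] by blast
      ultimately show ?thesis using in_cycle_region[OF C R(1) fp(2)] by blast
    qed
    moreover have "F \<noteq> {}" if "F \<in> sides e" for F using face_props(3)[OF sides_faces[OF that]] .
    ultimately have "sides e \<subseteq> S \<or> sides e \<inter> S = {}" using R(1) disj unfolding S_def by blast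
    then show ?thesis using False by (auto simp: edge_cut_def)
  qed
  then have "C = edge_cut dual (edges G) S"
    using is_cycle_subset[OF C] cut_subset[of dual "edges G" S] by blast
  then show ?thesis by blast
qed

text \<open>If every edge between \<open>S\<close> and its complement is in the forest
  \<open>T\<close>, the complement of the drawn forest is covered by two disjoint open sets, one
  from the faces in \<open>S\<close> and one from the other faces. As this complement is connected,
  one of the two classes of faces is empty.\<close>

lemma dual_cut_acyclic:
  assumes "T \<subseteq> edges G" "\<And>C. C \<subseteq> T \<Longrightarrow> \<not> is_cycle G C" "edge_cut dual (edges G) S \<subseteq> T"
  shows "edge_cut dual (edges G) S = {}"
proof -
  \<comment> \<open>The faces in \<open>A\<close>, glued across the edges outside \<open>T\<close>
    that have both sides in \<open>A\<close>. Repeating the sides next to each open arc adds no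
    points, but makes every member of the union open.\<close>
  define region where "region A = \<Union> (A \<inter> faces G p \<gamma>) \<union>
    (\<Union>e \<in> {e \<in> edges G - T. sides e \<subseteq> A}. \<Union> (sides e) \<union> open_arc e)" for A
  have op: "open (region A)" for A
    unfolding region_def using face_props(1) open_sides by (intro open_Un open_Union open_UN) auto
  have cover: "- partial_drawing T \<subseteq> region S \<union> region (- S)"
  proof
    fix x assume x: "x \<in> - partial_drawing T"
    show "x \<in> region S \<union> region (- S)"
    proof (cases "x \<in> partial_drawing (edges G)")
      case False
      then obtain F where "F \<in> faces G p \<gamma>" "x \<in> F"
        unfolding faces_def drawing_eq using Union_components[of "- partial_drawing (edges G)"] by blast
      then show ?thesis unfolding region_def by blast
    next
      case True
      then obtain e where e: "e \<in> edges G" "x \<in> path_image (\<gamma> e)" "e \<notin> T"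
        using x by (auto simp: partial_drawing_def)
      moreover have "x \<notin> p ` ends G e" using x ends_in_verts[OF e(1)] by (auto simp: partial_drawing_def)
      ultimately have "x \<in> open_arc e" using path_image_eq[OF e(1)] by blast
      moreover have "sides e \<subseteq> S \<or> sides e \<subseteq> - S"
        using e assms(3) by (auto simp: edge_cut_def)
      ultimately show ?thesis using e unfolding region_def by blast
    qed
  qed
  have disj: "region S \<inter> region (- S) = {}"
  proof -
    have eq: "region A = \<Union> (A \<inter> faces G p \<gamma>) \<union> (\<Union>e \<in> {e \<in> edges G - T. sides e \<subseteq> A}. open_arc e)" for A
      using sides_faces unfolding region_def by blast
    have "F \<inter> open_arc e = {}" if "F \<in> faces G p \<gamma>" "e \<in> edges G" for F e
      using face_props(4)[OF that(1)] path_image_eq[OF that(2)] that(2) by (auto simp: partial_drawing_def)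
    moreover have "F \<inter> F' = {}" if "F \<in> S \<inter> faces G p \<gamma>" "F' \<in> - S \<inter> faces G p \<gamma>" for F F'
      using face_disjoint[of F F'] that by blast
    moreover have "open_arc e \<inter> open_arc f = {}"
      if "e \<in> edges G" "f \<in> edges G" "sides e \<subseteq> S" "sides f \<subseteq> - S" for e f
    proof -
      have "sides e \<noteq> {}" using card_sides[OF that(1)] by auto
      then have "e \<noteq> f" using that by blast
      then show ?thesis using open_arc_path_image[OF that(1,2)] path_image_eq[OF that(2)] by blast
    qed
    ultimately show ?thesis unfolding eq by blast
  qed
  have hit: "region A \<inter> - partial_drawing T \<noteq> {}" if A: "A \<inter> faces G p \<gamma> \<noteq> {}" for A
  proof -
    obtain F where F: "F \<in> A" "F \<in> faces G p \<gamma>" using A by blast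
    then obtain x where x: "x \<in> F" using face_props(3) by blast
    then have "x \<in> region A" using F unfolding region_def by blast
    moreover have "x \<notin> partial_drawing T"
      using x face_props(4)[OF F(2)] partial_drawing_mono[OF assms(1)] by blast
    ultimately show ?thesis by blast
  qed
  have "connected (- partial_drawing T)" using connected_complement_acyclic assms(1,2) by simp
  then have "region S \<inter> - partial_drawing T = {} \<or> region (- S) \<inter> - partial_drawing T = {}"
    using disj by (intro connectedD[OF _ op op _ cover]) simp_all
  then have "S \<inter> faces G p \<gamma> = {} \<or> - S \<inter> faces G p \<gamma> = {}" using hit[of S] hit[of "- S"] by argo
  moreover have "sides e \<subseteq> faces G p \<gamma>" for e using sides_faces by auto
  ultimately show ?thesis unfolding edge_cut_def dual_simps by blast
qed

text \<open>Every dual cut is a sum of fundamental cycles of a spanning forest \<open>T\<close>. The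
  fundamental cycle of a cut edge \<open>e\<close> outside \<open>T\<close> is itself a dual cut,
  and \<open>e\<close> is its only edge outside \<open>T\<close>, so adding it lowers the number of
  cut edges outside \<open>T\<close> by one. A dual cut inside \<open>T\<close> is empty.\<close>

lemma even_in_cuts_dual_cut: "even_in_cuts G (edge_cut dual (edges G) S)"
proof -
  obtain T where T: "T \<subseteq> edges G" "\<forall>C \<subseteq> T. \<not> is_cycle G C"
    "\<forall>e \<in> edges G - T. \<exists>C \<subseteq> insert e T. e \<in> C \<and> is_cycle G C"
    using maximal_acyclic_edge_set by auto
  let ?cut = "edge_cut dual (edges G)"
  have sub: "?cut S \<subseteq> edges G" for S by (rule cut_subset)
  show ?thesis
  proof (induction "card (?cut S - T)" arbitrary: S rule: less_induct)
    case less
    show ?case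
    proof (cases "?cut S \<subseteq> T")
      case True
      have "?cut S = {}" using T(2) by (intro dual_cut_acyclic[OF T(1) _ True]) simp
      then show ?thesis by (simp add: even_in_cuts_def edge_cut_def[of G])
    next
      case False
      then obtain e where e: "e \<in> ?cut S - T" by blast
      then have "e \<in> edges G - T" using sub by blast
      then obtain C where C: "C \<subseteq> insert e T" "e \<in> C" "is_cycle G C" using T(3) by blast
      then obtain S' where S': "C = ?cut S'" using cycle_is_dual_cut[OF C(3)] by blast
      have cut: "?cut (sym_diff S S') = sym_diff (?cut S) C"
        using dual.cut_sym_diff[of "edges G" S S'] S' by simp
      have "?cut (sym_diff S S') - T = (?cut S - T) - {e}" unfolding cut using C e by blast
      moreover have "finite (?cut S - T)" using sub finite_edge_subset by blast
      ultimately have "card (?cut (sym_diff S S') - T) < card (?cut S - T)"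
        using e by (metis card_Diff1_less)
      then have "even_in_cuts G (?cut (sym_diff S S'))" by (rule less)
      then have "even_in_cuts G (sym_diff (?cut (sym_diff S S')) C)"
        by (intro even_in_cuts_sym_diff[OF sub is_cycle_subset[OF C(3)] _ even_in_cuts_cycle[OF C(3)]])
      moreover have "sym_diff (?cut (sym_diff S S')) C = ?cut S" unfolding cut by blast
      ultimately show ?thesis by simp
    qed
  qed
qed

lemma boundary_edges_eq:
  assumes "F \<in> faces G p \<gamma>"
  shows "boundary_edges G \<gamma> F = edge_cut dual (edges G) {F}"
proof -
  have "sides e - {F} \<noteq> {}" if "e \<in> edges G" for e using card_sides[OF that]
    by (metis Diff_eq_empty_iff card_2_iff' insertE empty_iff subset_singleton_iff)
  then show ?thesis using assms by (auto simp: boundary_edges_def edge_cut_def sides_def)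
qed

end

section \<open>Frustration\<close>

context loopless_graph
begin

text \<open>The negative edges in \<open>F\<close> after switching once at each vertex of
  \<open>X\<close>. Working with edge sets inside the fixed graph \<open>G\<close> avoids separate
  vertex sets for subgraphs.\<close>

definition switched :: "('e \<Rightarrow> edge_sign) \<Rightarrow> 'e set \<Rightarrow> 'v set \<Rightarrow> 'e set" where
  "switched \<sigma> F X = sym_diff {e \<in> F. \<sigma> e = Negative} (edge_cut G F X)"

definition frustration :: "('e \<Rightarrow> edge_sign) \<Rightarrow> 'e set \<Rightarrow> nat" where
  "frustration \<sigma> F = (LEAST n. \<exists>X. n = card (switched \<sigma> F X))"

lemma switched_subset: "switched \<sigma> F X \<subseteq> F"
  by (auto simp: switched_def edge_cut_def)

lemma switched_mono_eq: "A \<subseteq> B \<Longrightarrow> switched \<sigma> A X = A \<inter> switched \<sigma> B X"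
  by (auto simp: switched_def edge_cut_def)

lemma cut_singleton:
  assumes "F \<subseteq> edges G"
  shows "edge_cut G F {v} = {e \<in> F. v \<in> ends G e}"
proof -
  have "ends G e - {v} \<noteq> {}" if "e \<in> F" for e
    by (rule obtain_ends[OF assms that]) auto
  then show ?thesis by (auto simp: edge_cut_def)
qed

lemma switched_sym_diff:
  assumes "F \<subseteq> edges G"
  shows "switched \<sigma> F (sym_diff X Y) = sym_diff (switched \<sigma> F X) (edge_cut G F Y)"
  unfolding switched_def cut_sym_diff[OF assms] by auto

lemma negative_edges_switch:
  assumes "F \<subseteq> edges G" "edges H = F" "ends H = ends G" "negative_edges H \<tau> = switched \<sigma> F X"
  shows "negative_edges H (switch H v \<tau>) = switched \<sigma> F (sym_diff X {v})"
proof -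
  have "flip s = Negative \<longleftrightarrow> s \<noteq> Negative" for s by (cases s) auto
  then have "negative_edges H (switch H v \<tau>) = sym_diff (negative_edges H \<tau>) {e \<in> F. v \<in> ends G e}"
    using assms(2,3) unfolding negative_edges_def switch_def by auto
  then show ?thesis using assms(1,4) switched_sym_diff cut_singleton by simp
qed

text \<open>Two switchings at the same vertex cancel, so a sequence of switchings amounts to the set
  of vertices switched an odd number of times. \<open>H\<close> is a record of its own so that
  \<open>G\<close>, \<open>delete_edge\<close> and \<open>edge_induced\<close> are all
  covered.\<close>

lemma frustration_index_eq:
  assumes F: "edges H \<subseteq> edges G" and H: "ends H = ends G" "finite (verts H)"
    and V: "\<And>e. e \<in> edges H \<Longrightarrow> ends G e \<subseteq> verts H"
  shows "frustration_index H \<sigma> = frustration \<sigma> (edges H)"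
proof -
  have fwd: "\<exists>X. negative_edges H \<tau> = switched \<sigma> (edges H) X" if "switching_reachable H \<sigma> \<tau>" for \<tau>
    using that
  proof induction
    case base
    have "negative_edges H \<sigma> = switched \<sigma> (edges H) {}"
      by (auto simp: negative_edges_def switched_def edge_cut_def)
    then show ?case by blast
  next
    case (step \<tau> v)
    then show ?case using negative_edges_switch[OF F refl H(1)] by blast
  qed
  have bwd: "\<exists>\<tau>. switching_reachable H \<sigma> \<tau> \<and> negative_edges H \<tau> = switched \<sigma> (edges H) X" for X
  proof -
    have "\<exists>\<tau>. switching_reachable H \<sigma> \<tau> \<and> negative_edges H \<tau> = switched \<sigma> (edges H) Y"
      if "finite Y" "Y \<subseteq> verts H" for Y
      using that
    proof (induction Y rule: finite_induct)
      case empty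
      have "negative_edges H \<sigma> = switched \<sigma> (edges H) {}"
        by (auto simp: negative_edges_def switched_def edge_cut_def)
      then show ?case using switching_reachable.base by blast
    next
      case (insert v Y)
      then obtain \<tau> where \<tau>: "switching_reachable H \<sigma> \<tau>" "negative_edges H \<tau> = switched \<sigma> (edges H) Y"
        by auto
      have "sym_diff Y {v} = insert v Y" using insert.hyps by auto
      then have "negative_edges H (switch H v \<tau>) = switched \<sigma> (edges H) (insert v Y)"
        using negative_edges_switch[OF F refl H(1) \<tau>(2)] by metis
      moreover have "switching_reachable H \<sigma> (switch H v \<tau>)"
        using \<tau>(1) insert.prems by (auto intro: switching_reachable.step)
      ultimately show ?case by blast
    qed
    moreover have "finite (X \<inter> verts H)" "X \<inter> verts H \<subseteq> verts H" using H(2) by auto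
    ultimately obtain \<tau> where "switching_reachable H \<sigma> \<tau>"
      "negative_edges H \<tau> = switched \<sigma> (edges H) (X \<inter> verts H)" by blast
    \<comment> \<open>Vertices outside \<open>H\<close> are on no edge of \<open>H\<close>, so
      \<open>X\<close> may be cut down to the vertices where switching is allowed.\<close>
    moreover have "edge_cut G (edges H) X = edge_cut G (edges H) (X \<inter> verts H)"
      using V unfolding edge_cut_def by blast
    ultimately show ?thesis unfolding switched_def by auto
  qed
  have "(\<exists>\<tau>. switching_reachable H \<sigma> \<tau> \<and> n = card (negative_edges H \<tau>)) \<longleftrightarrow>
    (\<exists>X. n = card (switched \<sigma> (edges H) X))" for n
  proof
    assume "\<exists>\<tau>. switching_reachable H \<sigma> \<tau> \<and> n = card (negative_edges H \<tau>)"
    then obtain \<tau> where \<tau>: "switching_reachable H \<sigma> \<tau>" "n = card (negative_edges H \<tau>)" by blast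
    show "\<exists>X. n = card (switched \<sigma> (edges H) X)" using fwd[OF \<tau>(1)] \<tau>(2) by auto
  next
    assume "\<exists>X. n = card (switched \<sigma> (edges H) X)"
    then obtain X where X: "n = card (switched \<sigma> (edges H) X)" by blast
    show "\<exists>\<tau>. switching_reachable H \<sigma> \<tau> \<and> n = card (negative_edges H \<tau>)"
      using bwd[of X] X by auto
  qed
  then show ?thesis unfolding frustration_index_def frustration_def by simp
qed

lemma critically_frustrated_iff:
  "critically_frustrated k G \<sigma> \<longleftrightarrow>
    frustration \<sigma> (edges G) = k \<and> (\<forall>e\<in>edges G. int (frustration \<sigma> (edges G - {e})) = int k - 1)"
proof -
  have "frustration_index G \<sigma> = frustration \<sigma> (edges G)"
    using finite_verts ends_in_verts by (intro frustration_index_eq) auto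
  moreover have "frustration_index (delete_edge G e) \<sigma> = frustration \<sigma> (edges G - {e})" for e
    using frustration_index_eq[of "delete_edge G e" \<sigma>] finite_verts ends_in_verts
    by (auto simp: delete_edge_def)
  ultimately show ?thesis by (simp add: critically_frustrated_def)
qed

lemma critically_frustrated_edge_induced_iff:
  assumes "F \<subseteq> edges G"
  shows "critically_frustrated k (edge_induced G F) \<sigma> \<longleftrightarrow>
    frustration \<sigma> F = k \<and> (\<forall>e\<in>F. int (frustration \<sigma> (F - {e})) = int k - 1)"
proof -
  have "finite (\<Union>e\<in>F. ends G e)"
    using ends_in_verts assms finite_verts by (meson UN_least finite_subset subsetD)
  then have "frustration_index (edge_induced G F) \<sigma> = frustration \<sigma> F"
    "frustration_index (delete_edge (edge_induced G F) e) \<sigma> = frustration \<sigma> (F - {e})" for e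
    using frustration_index_eq[of "edge_induced G F" \<sigma>]
      frustration_index_eq[of "delete_edge (edge_induced G F) e" \<sigma>] assms
    by (auto simp: edge_induced_def delete_edge_def)
  then show ?thesis unfolding critically_frustrated_def by (simp add: edge_induced_def)
qed

section \<open>Bounds on frustration, and splittings\<close>

lemma frustration_le: "frustration \<sigma> F \<le> card (switched \<sigma> F X)"
  unfolding frustration_def by (rule Least_le) blast

lemma frustration_attained: "\<exists>X. frustration \<sigma> F = card (switched \<sigma> F X)"
  unfolding frustration_def by (rule LeastI_ex) blast

lemma frustration_Diff_le:
  assumes "F \<subseteq> edges G"
  shows "frustration \<sigma> F \<le> Suc (frustration \<sigma> (F - {e}))"
proof -
  obtain X where X: "frustration \<sigma> (F - {e}) = card (switched \<sigma> (F - {e}) X)"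
    using frustration_attained by blast
  have "finite (switched \<sigma> (F - {e}) X)"
    using finite_edge_subset[OF assms] switched_subset[of \<sigma> "F - {e}" X] by (meson finite_Diff finite_subset)
  moreover have "switched \<sigma> F X \<subseteq> insert e (switched \<sigma> (F - {e}) X)"
    using switched_mono_eq[of "F - {e}" F \<sigma> X] switched_subset[of \<sigma> F X] by blast
  ultimately have "card (switched \<sigma> F X) \<le> card (insert e (switched \<sigma> (F - {e}) X))"
    by (intro card_mono) auto
  also have "\<dots> \<le> Suc (card (switched \<sigma> (F - {e}) X))" using \<open>finite _\<close> by (simp add: card_insert_if)
  finally have "card (switched \<sigma> F X) \<le> Suc (card (switched \<sigma> (F - {e}) X))" .
  then show ?thesis using X frustration_le[of \<sigma> F X] by linarith
qed

text \<open>A negative element of the cycle space. It generalises negative cycles, so that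
  boundaries of sets of faces can be used without being decomposed into cycles.\<close>

definition odd_set :: "('e \<Rightarrow> edge_sign) \<Rightarrow> 'e set \<Rightarrow> bool" where
  "odd_set \<sigma> Z \<longleftrightarrow> Z \<subseteq> edges G \<and> even_in_cuts G Z \<and> odd (card {e \<in> Z. \<sigma> e = Negative})"

text \<open>Switching changes the negative edges of \<open>Z\<close> by a cut, and a cut meets
  \<open>Z\<close> evenly.\<close>

lemma odd_set_meets_switched:
  assumes "odd_set \<sigma> Z" "Z \<subseteq> F"
  shows "odd (card (Z \<inter> switched \<sigma> F X))"
proof -
  have fin: "finite Z" using assms(1) finite_edge_subset by (auto simp: odd_set_def)
  have "Z \<inter> switched \<sigma> F X = sym_diff {e \<in> Z. \<sigma> e = Negative} (edge_cut G Z X)"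
    using assms(2) by (auto simp: switched_def edge_cut_def)
  moreover have "finite {e \<in> Z. \<sigma> e = Negative}" "finite (edge_cut G Z X)"
    using fin by (auto simp: edge_cut_def)
  ultimately show ?thesis
    using even_card_sym_diff[of "{e \<in> Z. \<sigma> e = Negative}" "edge_cut G Z X"] assms(1)
    by (simp add: odd_set_def even_in_cuts_def)
qed

lemma frustration_ge_1:
  assumes "odd_set \<sigma> Z" "Z \<subseteq> F" "F \<subseteq> edges G"
  shows "1 \<le> frustration \<sigma> F"
proof -
  obtain X where X: "frustration \<sigma> F = card (switched \<sigma> F X)" using frustration_attained by blast
  have "Z \<inter> switched \<sigma> F X \<noteq> {}" using odd_set_meets_switched[OF assms(1,2), of X] by auto
  moreover have "finite (switched \<sigma> F X)" using finite_edge_subset assms(3) switched_subset by (metis finite_subset)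
  ultimately have "card (switched \<sigma> F X) \<noteq> 0" by auto
  then show ?thesis using X by simp
qed

text \<open>A single edge that meets all members of the family would be in their
  intersection.\<close>

lemma frustration_ge_2:
  assumes "\<And>Z. Z \<in> \<Z> \<Longrightarrow> odd_set \<sigma> Z \<and> Z \<subseteq> F" "\<Z> \<noteq> {}" "\<Inter> \<Z> = {}" "F \<subseteq> edges G"
  shows "2 \<le> frustration \<sigma> F"
proof (rule ccontr)
  assume small: "\<not> 2 \<le> frustration \<sigma> F"
  obtain X where X: "frustration \<sigma> F = card (switched \<sigma> F X)" using frustration_attained by blast
  obtain Z where "Z \<in> \<Z>" using assms(2) by blast
  then have "1 \<le> frustration \<sigma> F" using assms(1,4) frustration_ge_1 by blast
  then have "card (switched \<sigma> F X) = 1" using small X by simp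
  then obtain e where e: "switched \<sigma> F X = {e}" by (auto simp: card_1_singleton_iff)
  have "e \<in> Z" if "Z \<in> \<Z>" for Z
  proof (rule ccontr)
    assume "e \<notin> Z"
    then have "Z \<inter> switched \<sigma> F X = {}" using e by simp
    then show False using odd_set_meets_switched[of \<sigma> Z F X] assms(1)[OF that] by simp
  qed
  then show False using assms(3) by blast
qed

text \<open>The switching that is optimal without \<open>e\<close> must leave \<open>e\<close>
  negative; otherwise it would give only \<open>k\<close> negative edges in
  \<open>G\<close>.\<close>

lemma critical_edge_in_minimum:
  assumes "frustration \<sigma> (edges G) = Suc k" "frustration \<sigma> (edges G - {e}) = k" "e \<in> edges G"
  shows "\<exists>X. e \<in> switched \<sigma> (edges G) X \<and> card (switched \<sigma> (edges G) X) = Suc k"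
proof -
  obtain X where X: "k = card (switched \<sigma> (edges G - {e}) X)" using frustration_attained assms(2) by metis
  let ?J = "switched \<sigma> (edges G) X"
  have eq: "switched \<sigma> (edges G - {e}) X = ?J - {e}"
    using switched_mono_eq[of "edges G - {e}" "edges G" \<sigma> X] switched_subset[of \<sigma> "edges G" X] by blast
  have fin: "finite ?J" using switched_subset[of \<sigma> "edges G" X] finite_edge_subset by blast
  have "Suc k \<le> card ?J" using frustration_le[of \<sigma> "edges G" X] assms(1) by simp
  then have "e \<in> ?J" using X eq by (cases "e \<in> ?J") auto
  then show ?thesis using X eq fin by (metis card_Suc_Diff1)
qed

text \<open>If \<open>e\<close> were a bridge, switching one of its sides would remove it from a
  minimum set and change no other sign.\<close>

lemma critical_edge_in_cycle:
  assumes "frustration \<sigma> (edges G) = Suc k" "frustration \<sigma> (edges G - {e}) = k" "e \<in> edges G"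
  shows "\<exists>C. is_cycle G C \<and> e \<in> C"
proof -
  obtain X where X: "e \<in> switched \<sigma> (edges G) X" "card (switched \<sigma> (edges G) X) = Suc k"
    using critical_edge_in_minimum[OF assms] by blast
  obtain u w where uw: "ends G e = {u, w}" by (rule obtain_ends[OF subset_refl assms(3)])
  show ?thesis
  proof (cases "w \<in> component G (edges G - {e}) u")
    case True
    then show ?thesis using cycle_through_edge[OF subset_refl assms(3) uw] by blast
  next
    case False
    let ?Y = "component G (edges G - {e}) u"
    have "switched \<sigma> (edges G) (sym_diff X ?Y) = switched \<sigma> (edges G) X - {e}"
      using switched_sym_diff[of "edges G" \<sigma> X ?Y] cut_component_bridge[OF subset_refl assms(3) uw False] X(1)
      by auto
    then have "card (switched \<sigma> (edges G) (sym_diff X ?Y)) = k" using X by simp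
    then show ?thesis using frustration_le[of \<sigma> "edges G" "sym_diff X ?Y"] assms(1) by simp
  qed
qed

text \<open>A minimum set has three elements, at least one in \<open>A\<close> and at least two
  outside, hence exactly one and two. If it is chosen through \<open>e\<close>, deleting
  \<open>e\<close> lowers the bound of the part containing \<open>e\<close>, so both parts are
  critical.\<close>

lemma decomposable_3_if_split:
  assumes crit: "critically_frustrated 3 G \<sigma>" and A: "A \<subseteq> edges G"
    and low: "1 \<le> frustration \<sigma> A" "2 \<le> frustration \<sigma> (edges G - A)"
  shows "decomposable 3 G \<sigma>"
proof -
  let ?E = "edges G" and ?B = "edges G - A"
  have fr: "frustration \<sigma> ?E = Suc 2" and fr': "\<And>e. e \<in> ?E \<Longrightarrow> frustration \<sigma> (?E - {e}) = 2"
    using crit by (auto simp: critically_frustrated_iff)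
  have key: "frustration \<sigma> A = 1 \<and> frustration \<sigma> ?B = 2 \<and>
    (e \<in> A \<longrightarrow> frustration \<sigma> (A - {e}) = 0) \<and> (e \<in> ?B \<longrightarrow> frustration \<sigma> (?B - {e}) \<le> 1)"
    if e: "e \<in> ?E" for e
  proof -
    obtain X where X: "e \<in> switched \<sigma> ?E X" "card (switched \<sigma> ?E X) = 3"
      using critical_edge_in_minimum[OF fr fr'[OF e] e] by auto
    let ?J = "switched \<sigma> ?E X"
    have J: "?J \<subseteq> ?E" "finite ?J" using switched_subset[of \<sigma> ?E X] finite_edge_subset by auto
    have sw: "switched \<sigma> F X = F \<inter> ?J" if "F \<subseteq> ?E" for F using switched_mono_eq[OF that] .
    have le: "frustration \<sigma> F \<le> card (F \<inter> ?J)" if "F \<subseteq> ?E" for F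
      using frustration_le[of \<sigma> F X] sw[OF that] by simp
    have "card (A \<inter> ?J) + card (?B \<inter> ?J) = card ?J"
      using J by (subst card_Un_disjoint[symmetric]) (auto intro: arg_cong[of _ _ card])
    then have cards: "card (A \<inter> ?J) = 1" "card (?B \<inter> ?J) = 2"
      using le[of A] le[of ?B] A low X(2) by auto
    have "card ((A - {e}) \<inter> ?J) = 0" if "e \<in> A"
    proof -
      have "(A - {e}) \<inter> ?J = A \<inter> ?J - {e}" by blast
      then show ?thesis using cards(1) X(1) that J(2) by (simp only: card_Diff_singleton IntI)
    qed
    moreover have "card ((?B - {e}) \<inter> ?J) = 1" if "e \<in> ?B"
    proof -
      have "(?B - {e}) \<inter> ?J = ?B \<inter> ?J - {e}" by blast
      then show ?thesis using cards(2) X(1) that J(2) by (simp only: card_Diff_singleton IntI)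
    qed
    moreover have "A - {e} \<subseteq> ?E" "?B \<subseteq> ?E" "?B - {e} \<subseteq> ?E" using A by auto
    ultimately show ?thesis
      using cards low le[OF A] le[of ?B] le[of "A - {e}"] le[of "?B - {e}"] by auto
  qed
  \<comment> \<open>\<open>key\<close> gives the two frustration values only in the presence of some
    edge.\<close>
  have "?E \<noteq> {}"
  proof
    assume "?E = {}"
    then have "card (switched \<sigma> ?E {}) = 0" by (simp add: switched_def edge_cut_def)
    then show False using frustration_le[of \<sigma> ?E "{}"] fr by simp
  qed
  then obtain e0 where "e0 \<in> ?E" by blast
  then have total: "frustration \<sigma> A = 1" "frustration \<sigma> ?B = 2" using key by blast+
  have "frustration \<sigma> (?B - {e}) = 1" if "e \<in> ?B" for e
    using key[of e] that total(2) frustration_Diff_le[of ?B \<sigma> e] by auto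
  then have "critically_frustrated 2 (edge_induced G ?B) \<sigma>"
    using total by (subst critically_frustrated_edge_induced_iff) auto
  moreover have "critically_frustrated 1 (edge_induced G A) \<sigma>"
    using total key A by (subst critically_frustrated_edge_induced_iff) auto
  moreover have "{1..2} = {1::nat, 2}" by auto
  ultimately show ?thesis unfolding decomposable_def using A
    by (intro exI[of _ "2::nat"] conjI exI[of _ "\<lambda>i. i"] exI[of _ "\<lambda>i. if i = 1 then A else ?B"])
      (auto simp: disjoint_family_on_def)
qed

end

section \<open>Joins in the dual\<close>

text \<open>The combinatorial content of planarity: by the last two assumptions the cycle space of
  \<open>G\<close> is the cut space of \<open>D\<close>. No topology is used from here until faces
  are identified in the theorem.\<close>

locale dual_pair = loopless_graph G + dual: loopless_graph D
  for G :: "('v, 'e) multigraph" and D :: "('f, 'e) multigraph" +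
  assumes edges_dual: "edges D = edges G"
    and cycle_is_dual_cut: "is_cycle G C \<Longrightarrow> \<exists>S. C = edge_cut D (edges G) S"
    and even_in_cuts_dual_cut: "even_in_cuts G (edge_cut D (edges G) S)"
begin

abbreviation bd :: "'f set \<Rightarrow> 'e set" where
  "bd S \<equiv> edge_cut D (edges G) S"

text \<open>The set T for which \<open>J\<close> is a T-join in the dual. Intersecting with
  \<open>bd {F}\<close> discards names that are not edges, so
  \<open>{e. \<sigma> e = Negative}\<close> can be inserted directly.\<close>

definition odd_faces :: "'e set \<Rightarrow> 'f set" where
  "odd_faces J = {F. odd (card (bd {F} \<inter> J))}"

lemma finite_bd: "finite (bd S)"
  using finite_edges cut_subset by (metis finite_subset)

lemma bd_subset: "bd S \<subseteq> edges G"
  by (rule cut_subset)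

lemma bd_sym_diff: "bd (sym_diff S S') = sym_diff (bd S) (bd S')"
  by (rule dual.cut_sym_diff) (simp add: edges_dual)

lemma bd_singleton: "bd {F} = {e \<in> edges G. F \<in> ends D e}"
  by (rule dual.cut_singleton) (simp add: edges_dual)

lemma dual_ends:
  assumes "e \<in> edges G"
  obtains F1 F2 where "ends D e = {F1, F2}" "F1 \<noteq> F2"
  using dual.obtain_ends[OF subset_refl] assms edges_dual by metis

lemma dual_ends_eqI:
  assumes "e \<in> edges G" "x \<in> ends D e" "y \<in> ends D e" "x \<noteq> y"
  shows "ends D e = {x, y}"
  by (rule dual_ends[OF assms(1)]) (use assms in auto)

lemma bd_Int_verts: "bd S = bd (S \<inter> verts D)"
  using dual.ends_in_verts edges_dual unfolding edge_cut_def by blast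

lemma odd_faces_verts: "odd_faces J \<subseteq> verts D"
proof
  fix F assume "F \<in> odd_faces J"
  then have "bd {F} \<inter> J \<noteq> {}" unfolding odd_faces_def by (metis card.empty even_zero mem_Collect_eq)
  then obtain e where "e \<in> edges G" "F \<in> ends D e" by (auto simp: bd_singleton)
  then show "F \<in> verts D" using dual.ends_in_verts edges_dual by blast
qed

lemma finite_odd_faces: "finite (odd_faces J)"
  using odd_faces_verts dual.finite_verts by (rule finite_subset)

lemma odd_card_bd_Int:
  assumes "finite S"
  shows "odd (card (bd S \<inter> J)) \<longleftrightarrow> odd (card (S \<inter> odd_faces J))"
  using assms
proof (induction S rule: finite_induct)
  case empty
  then show ?case by (simp add: edge_cut_def)
next
  case (insert F S)
  have "insert F S = sym_diff S {F}" using insert.hyps by auto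
  then have "bd (insert F S) = sym_diff (bd S) (bd {F})" using bd_sym_diff by metis
  then have "bd (insert F S) \<inter> J = sym_diff (bd S \<inter> J) (bd {F} \<inter> J)" by blast
  then have "odd (card (bd (insert F S) \<inter> J)) \<longleftrightarrow> odd (card (S \<inter> odd_faces J)) \<noteq> (F \<in> odd_faces J)"
    using even_card_sym_diff[of "bd S \<inter> J" "bd {F} \<inter> J"] finite_bd insert.IH
    by (auto simp: odd_faces_def)
  then show ?case using insert.hyps by (auto simp: Int_insert_left)
qed

lemma odd_faces_sym_diff: "odd_faces (sym_diff A B) = sym_diff (odd_faces A) (odd_faces B)"
proof (rule set_eqI)
  fix F
  have "bd {F} \<inter> sym_diff A B = sym_diff (bd {F} \<inter> A) (bd {F} \<inter> B)" by blast
  then show "F \<in> odd_faces (sym_diff A B) \<longleftrightarrow> F \<in> sym_diff (odd_faces A) (odd_faces B)"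
    using even_card_sym_diff[of "bd {F} \<inter> A" "bd {F} \<inter> B"] finite_bd by (auto simp: odd_faces_def)
qed

lemma odd_faces_empty: "odd_faces {} = {}"
  by (simp add: odd_faces_def)

lemma odd_faces_singleton:
  assumes "e \<in> edges G"
  shows "odd_faces {e} = ends D e"
proof -
  have "bd {F} \<inter> {e} = (if F \<in> ends D e then {e} else {})" for F
    using assms by (auto simp: bd_singleton)
  then show ?thesis by (simp add: odd_faces_def)
qed

lemma even_card_odd_faces: "even (card (odd_faces J))"
proof -
  have "bd (verts D) = {}"
    using dual.ends_in_verts edges_dual by (auto simp: edge_cut_def)
  moreover have "verts D \<inter> odd_faces J = odd_faces J" using odd_faces_verts by blast
  ultimately show ?thesis using odd_card_bd_Int[OF dual.finite_verts, of J] by simp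
qed

lemma odd_faces_subset_ends:
  assumes "J \<subseteq> edges G"
  shows "odd_faces J \<subseteq> (\<Union>e\<in>J. ends D e)"
proof
  fix F assume "F \<in> odd_faces J"
  then have "bd {F} \<inter> J \<noteq> {}" unfolding odd_faces_def by (metis card.empty even_zero mem_Collect_eq)
  then show "F \<in> (\<Union>e\<in>J. ends D e)" by (auto simp: bd_singleton)
qed

text \<open>Switching adds a cut of \<open>G\<close>, which meets each face boundary evenly.\<close>

lemma odd_faces_switched: "odd_faces (switched \<sigma> (edges G) X) = odd_faces {e. \<sigma> e = Negative}"
proof -
  have "bd {F} \<inter> switched \<sigma> (edges G) X =
      sym_diff (bd {F} \<inter> {e. \<sigma> e = Negative}) (edge_cut G (bd {F}) X)" for F
    using bd_subset by (auto simp: switched_def edge_cut_def[of G])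
  moreover have "finite (edge_cut G (bd {F}) X)" "even (card (edge_cut G (bd {F}) X))" for F
    using finite_bd cut_subset even_in_cuts_dual_cut by (metis finite_subset, simp add: even_in_cuts_def)
  ultimately show ?thesis
    using even_card_sym_diff[OF finite_Int[OF disjI1[OF finite_bd]]] by (simp add: odd_faces_def)
qed

text \<open>The converse: the difference of two joins for the same T meets every cycle evenly,
  because a cycle is a dual cut; so this difference is a cut of \<open>G\<close>.\<close>

lemma switched_if_odd_faces_eq:
  assumes "J \<subseteq> edges G" "odd_faces J = odd_faces {e. \<sigma> e = Negative}"
  shows "\<exists>X. J = switched \<sigma> (edges G) X"
proof -
  let ?N = "{e \<in> edges G. \<sigma> e = Negative}"
  have "even (card (C \<inter> sym_diff J ?N))" if C: "is_cycle G C" for C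
  proof -
    obtain S where "C = bd S" using cycle_is_dual_cut[OF C] by blast
    then have S: "C = bd (S \<inter> verts D)" "finite (S \<inter> verts D)"
      using bd_Int_verts dual.finite_verts by auto
    have "C \<inter> sym_diff J ?N = sym_diff (C \<inter> J) (C \<inter> {e. \<sigma> e = Negative})"
      using is_cycle_subset[OF C] by blast
    moreover have "finite C" using S(1) finite_bd by simp
    moreover have "odd (card (C \<inter> J)) \<longleftrightarrow> odd (card (C \<inter> {e. \<sigma> e = Negative}))"
      using odd_card_bd_Int[OF S(2)] S(1) assms(2) by simp
    ultimately show ?thesis using even_card_sym_diff[of "C \<inter> J" "C \<inter> {e. \<sigma> e = Negative}"] by simp
  qed
  then obtain X where "sym_diff J ?N = edge_cut G (edges G) X"
    using cut_if_even_on_cycles[of "edges G" "sym_diff J ?N"] assms(1) by auto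
  then have "J = switched \<sigma> (edges G) X" unfolding switched_def by blast
  then show ?thesis by blast
qed

end

section \<open>Negative faces and forbidden configurations\<close>

locale critical_dual_pair = dual_pair G D
  for G :: "('v, 'e) multigraph" and D :: "('f, 'e) multigraph" +
  fixes \<sigma> :: "'e \<Rightarrow> edge_sign"
  assumes critical: "critically_frustrated 3 G \<sigma>" and not_decomposable: "\<not> decomposable 3 G \<sigma>"
begin

definition negative_faces :: "'f set" where
  "negative_faces = odd_faces {e. \<sigma> e = Negative}"

lemma frustration_3: "frustration \<sigma> (edges G) = 3"
  and frustration_delete: "e \<in> edges G \<Longrightarrow> frustration \<sigma> (edges G - {e}) = 2"
  using critical by (auto simp: critically_frustrated_iff)

lemma card_ge_3_if_odd_faces_eq:
  assumes "J \<subseteq> edges G" "odd_faces J = negative_faces"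
  shows "3 \<le> card J"
proof -
  obtain X where "J = switched \<sigma> (edges G) X"
    using switched_if_odd_faces_eq[OF assms(1)] assms(2) by (auto simp: negative_faces_def)
  then show ?thesis using frustration_le[of \<sigma> "edges G" X] frustration_3 by simp
qed

lemma negative_faces_nonempty: "negative_faces \<noteq> {}"
  using card_ge_3_if_odd_faces_eq[of "{}"] odd_faces_empty by auto

lemma negative_faces_neq_ends:
  assumes "e \<in> edges G"
  shows "negative_faces \<noteq> ends D e"
  using card_ge_3_if_odd_faces_eq[of "{e}"] odd_faces_singleton[OF assms] assms by auto

text \<open>Otherwise there would be a join with at most two edges. The symmetric difference covers
  both a matching of four faces and a path of length two between two faces.\<close>

lemma negative_faces_neq_sym_diff:
  assumes "e \<in> edges G" "f \<in> edges G"
  shows "negative_faces \<noteq> sym_diff (ends D e) (ends D f)"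
proof
  assume "negative_faces = sym_diff (ends D e) (ends D f)"
  then have "odd_faces (sym_diff {e} {f}) = negative_faces"
    using odd_faces_sym_diff[of "{e}" "{f}"] odd_faces_singleton assms by simp
  then have "3 \<le> card (sym_diff {e} {f})" using assms by (intro card_ge_3_if_odd_faces_eq) auto
  moreover have "card (sym_diff {e} {f}) \<le> card {e, f}" by (intro card_mono) auto
  moreover have "card {e, f} \<le> 2" by (simp add: card_insert_if)
  ultimately show False by simp
qed

lemma minimum_join_through_edge:
  assumes "e \<in> edges G"
  shows "\<exists>J \<subseteq> edges G. e \<in> J \<and> card J = 3 \<and> odd_faces J = negative_faces"
proof -
  obtain X where "e \<in> switched \<sigma> (edges G) X" "card (switched \<sigma> (edges G) X) = 3"
    using critical_edge_in_minimum[of \<sigma> 2 e] frustration_3 frustration_delete[OF assms] assms by auto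
  then show ?thesis using odd_faces_switched[of \<sigma> X] switched_subset[of \<sigma> "edges G" X]
    unfolding negative_faces_def by blast
qed

lemma edges_nonempty: "edges G \<noteq> {}"
proof
  assume "edges G = {}"
  then have "negative_faces = {}" by (simp add: negative_faces_def odd_faces_def edge_cut_def)
  then show False using negative_faces_nonempty by simp
qed

lemma card_join_ends_le:
  assumes "J \<subseteq> edges G" "card J = 3"
  shows "card (\<Union>e\<in>J. ends D e) \<le> 6" "finite (\<Union>e\<in>J. ends D e)"
proof -
  have fin: "finite J" using assms(1) finite_edge_subset by blast
  have two: "card (ends D e) = 2" if "e \<in> J" for e
    using dual.card_ends that assms(1) edges_dual by blast
  have "card (\<Union>e\<in>J. ends D e) \<le> (\<Sum>e\<in>J. card (ends D e))" using fin by (rule card_UN_le)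
  also have "\<dots> = (\<Sum>e\<in>J. 2)" using two by (intro sum.cong) auto
  finally show "card (\<Union>e\<in>J. ends D e) \<le> 6" using assms(2) by simp
  have "finite (ends D e)" if "e \<in> J" for e using two[OF that] card.infinite by fastforce
  then show "finite (\<Union>e\<in>J. ends D e)" using fin by blast
qed

lemma card_negative_faces_le: "card negative_faces \<le> 6"
proof -
  obtain e where "e \<in> edges G" using edges_nonempty by blast
  then obtain J where J: "J \<subseteq> edges G" "card J = 3" "odd_faces J = negative_faces"
    using minimum_join_through_edge by blast
  have "negative_faces \<subseteq> (\<Union>e\<in>J. ends D e)" using odd_faces_subset_ends[OF J(1)] J(3) by simp
  then show ?thesis using card_join_ends_le[OF J(1,2)] card_mono le_trans by metis
qed

lemma odd_set_bd:
  assumes "finite S" "odd (card (S \<inter> negative_faces))"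
  shows "odd_set \<sigma> (bd S)"
proof -
  have "{e \<in> bd S. \<sigma> e = Negative} = bd S \<inter> {e. \<sigma> e = Negative}" by blast
  then show ?thesis
    using odd_card_bd_Int[OF assms(1)] assms(2) bd_subset even_in_cuts_dual_cut
    by (simp add: odd_set_def negative_faces_def)
qed

text \<open>All later contradictions have this form: \<open>X\<close> forces frustration at least 1
  on itself, and the family forces at least 2 on the remaining edges.\<close>

lemma no_split:
  assumes X: "odd_set \<sigma> X" and \<Z>: "\<Z> \<noteq> {}" "\<Inter> \<Z> = {}" "\<And>Z. Z \<in> \<Z> \<Longrightarrow> odd_set \<sigma> Z \<and> X \<inter> Z = {}"
  shows False
proof -
  have sub: "X \<subseteq> edges G" using X by (simp add: odd_set_def)
  have "1 \<le> frustration \<sigma> X" using frustration_ge_1[OF X subset_refl sub] .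
  moreover have "2 \<le> frustration \<sigma> (edges G - X)"
  proof (rule frustration_ge_2[OF _ \<Z>(1,2)])
    show "odd_set \<sigma> Z \<and> Z \<subseteq> edges G - X" if "Z \<in> \<Z>" for Z
      using \<Z>(3)[OF that] unfolding odd_set_def by blast
  qed simp
  ultimately show False using decomposable_3_if_split[OF critical sub] not_decomposable by blast
qed

definition adjacent :: "'f \<Rightarrow> 'f \<Rightarrow> bool" where
  "adjacent x y \<longleftrightarrow> (\<exists>e\<in>edges G. ends D e = {x, y})"

lemma adjacent_commute: "adjacent x y \<longleftrightarrow> adjacent y x"
  by (simp add: adjacent_def insert_commute)

lemma bd_disjoint_if_not_adjacent:
  assumes "x \<noteq> y" "\<not> adjacent x y"
  shows "bd {x} \<inter> bd {y} = {}"
  using assms dual_ends_eqI unfolding adjacent_def bd_singleton by fastforce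

lemma odd_set_bd_negative_face:
  assumes "x \<in> negative_faces"
  shows "odd_set \<sigma> (bd {x})"
  using assms by (intro odd_set_bd) auto

lemma bd_triple_Int:
  assumes "x \<noteq> y" "y \<noteq> z" "x \<noteq> z"
  shows "bd {x} \<inter> bd {y} \<inter> bd {z} = {}"
proof -
  have False if e: "e \<in> edges G" "x \<in> ends D e" "y \<in> ends D e" "z \<in> ends D e" for e
    using dual_ends_eqI[OF e(1-3) assms(1)] e(4) assms by auto
  then show ?thesis by (auto simp: bd_singleton)
qed

text \<open>The boundary of \<open>d\<close> is split off. The other three boundaries may overlap in
  pairs, but no edge has three sides.\<close>

lemma no_nonadjacent_star:
  assumes "{a, b, c, d} \<subseteq> negative_faces" "distinct [a, b, c, d]"
    and "\<not> adjacent d a" "\<not> adjacent d b" "\<not> adjacent d c"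
  shows False
proof (rule no_split)
  show "odd_set \<sigma> (bd {d})" using assms by (intro odd_set_bd_negative_face) auto
  show "{bd {a}, bd {b}, bd {c}} \<noteq> {}" by simp
  show "\<Inter> {bd {a}, bd {b}, bd {c}} = {}" using bd_triple_Int[of a b c] assms(2) by auto
  have "odd_set \<sigma> (bd {x}) \<and> bd {d} \<inter> bd {x} = {}" if "x \<in> {a, b, c}" for x
    using that assms by (intro conjI odd_set_bd_negative_face bd_disjoint_if_not_adjacent) auto
  then show "odd_set \<sigma> Z \<and> bd {d} \<inter> Z = {}" if "Z \<in> {bd {a}, bd {b}, bd {c}}" for Z
    using that by blast
qed

text \<open>Here two boundaries suffice besides the one split off, since they are disjoint.\<close>

lemma no_nonadjacent_triangle:
  assumes "{a, b, c} \<subseteq> negative_faces" "distinct [a, b, c]"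
    and "\<not> adjacent a b" "\<not> adjacent b c" "\<not> adjacent a c"
  shows False
proof (rule no_split)
  show "odd_set \<sigma> (bd {a})" using assms by (intro odd_set_bd_negative_face) auto
  show "{bd {b}, bd {c}} \<noteq> {}" by simp
  show "\<Inter> {bd {b}, bd {c}} = {}" using bd_disjoint_if_not_adjacent[of b c] assms by auto
  have "odd_set \<sigma> (bd {x}) \<and> bd {a} \<inter> bd {x} = {}" if "x \<in> {b, c}" for x
    using that assms by (intro conjI odd_set_bd_negative_face bd_disjoint_if_not_adjacent) auto
  then show "odd_set \<sigma> Z \<and> bd {a} \<inter> Z = {}" if "Z \<in> {bd {b}, bd {c}}" for Z
    using that by blast
qed

text \<open>
  The two negative faces are at distance at least 3 in the dual, so the boundaries of s, of t
  and of the closed neighbourhood of s are disjoint.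
\<close>

lemma card_negative_faces_neq_2: "card negative_faces \<noteq> 2"
proof
  assume "card negative_faces = 2"
  then obtain s t where st: "negative_faces = {s, t}" "s \<noteq> t" by (auto simp: card_2_iff)
  define S where "S = insert s {F \<in> verts D. adjacent s F}"
  have nst: "\<not> adjacent s t" using negative_faces_neq_ends st(1) by (auto simp: adjacent_def)
  have "t \<notin> S" using nst st(2) by (auto simp: S_def)
  \<comment> \<open>With exactly one negative face in \<open>S\<close>, its boundary is an odd
    set.\<close>
  then have "S \<inter> negative_faces = {s}" using st by (auto simp: S_def)
  then have oddS: "odd_set \<sigma> (bd S)"
    using dual.finite_verts by (intro odd_set_bd) (auto simp: S_def)
  have sS: "bd {s} \<inter> bd S = {}"
  proof -
    have False if e: "e \<in> bd {s}" "e \<in> bd S" for e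
    proof -
      have eE: "e \<in> edges G" and s: "s \<in> ends D e" using e(1) by (auto simp: bd_singleton)
      obtain F where F: "F \<in> ends D e" "F \<notin> S" using e(2) by (auto simp: edge_cut_def)
      have "s \<noteq> F" using F(2) by (auto simp: S_def)
      then have "adjacent s F" using dual_ends_eqI[OF eE s F(1)] eE by (auto simp: adjacent_def)
      moreover have "F \<in> verts D" using dual.ends_in_verts[of e] eE F(1) edges_dual by auto
      ultimately show False using F(2) by (simp add: S_def)
    qed
    then show ?thesis by blast
  qed
  have tS: "bd {t} \<inter> bd S = {}"
  proof -
    have False if e: "e \<in> bd {t}" "e \<in> bd S" for e
    proof -
      have eE: "e \<in> edges G" and t: "t \<in> ends D e" using e(1) by (auto simp: bd_singleton)
      obtain u where u: "u \<in> ends D e" "u \<in> S" using e(2) by (auto simp: edge_cut_def)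
      have "u \<noteq> t" using u(2) \<open>t \<notin> S\<close> by blast
      then have ee: "ends D e = {u, t}" using dual_ends_eqI[OF eE u(1) t] by simp
      then have "u \<noteq> s" using nst eE by (auto simp: adjacent_def)
      then have "adjacent s u" using u(2) by (simp add: S_def)
      then obtain f where f: "f \<in> edges G" "ends D f = {s, u}" by (auto simp: adjacent_def)
      \<comment> \<open>The dual path from \<open>s\<close> through \<open>u\<close> to
        \<open>t\<close> would be a join with two edges.\<close>
      have "sym_diff (ends D f) (ends D e) = {s, t}" using ee f(2) st(2) \<open>u \<noteq> s\<close> \<open>u \<noteq> t\<close> by auto
      then show False using negative_faces_neq_sym_diff[OF f(1) eE] st(1) by simp
    qed
    then show ?thesis by blast
  qed
  have st': "bd {s} \<inter> bd {t} = {}" using bd_disjoint_if_not_adjacent st(2) nst by blast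
  show False
  proof (rule no_split[of "bd {s}" "{bd S, bd {t}}"])
    show "odd_set \<sigma> (bd {s})" using st by (intro odd_set_bd_negative_face) simp
    show "\<Inter> {bd S, bd {t}} = {}" using tS by auto
    show "odd_set \<sigma> Z \<and> bd {s} \<inter> Z = {}" if "Z \<in> {bd S, bd {t}}" for Z
      using that oddS odd_set_bd_negative_face[of t] st sS st' by auto
  qed simp
qed

text \<open>
  No perfect matching on the four negative faces, so there is a nonadjacent pair in each of the
  three pairings; three such pairs form a star or a triangle.
\<close>

lemma card_negative_faces_neq_4: "card negative_faces \<noteq> 4"
proof
  assume "card negative_faces = 4"
  then obtain a A where "negative_faces = insert a A" "a \<notin> A" "card A = 3"
    by (metis card_Suc_eq numeral_eq_Suc eval_nat_numeral(2) semiring_norm(26) semiring_norm(27))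
  moreover from this obtain b c d where "A = {b, c, d}" "b \<noteq> c" "c \<noteq> d" "b \<noteq> d"
    by (auto simp: card_3_iff)
  ultimately have T: "negative_faces = {a, b, c, d}" and dist: "distinct [a, b, c, d]" by auto
  have pair: "\<not> adjacent w x \<or> \<not> adjacent y z"
    if p: "{w, x, y, z} = {a, b, c, d}" "distinct [w, x, y, z]" for w x y z
  proof (rule ccontr)
    assume "\<not> (\<not> adjacent w x \<or> \<not> adjacent y z)"
    then obtain e f where ef: "e \<in> edges G" "ends D e = {w, x}" "f \<in> edges G" "ends D f = {y, z}"
      by (auto simp: adjacent_def)
    have "sym_diff {w, x} {y, z} = {w, x, y, z}" using p(2) by auto
    then show False using negative_faces_neq_sym_diff[OF ef(1,3)] ef(2,4) T p(1) by simp
  qed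
  have p1: "\<not> adjacent a b \<or> \<not> adjacent c d" using dist by (intro pair) auto
  have p2: "\<not> adjacent a c \<or> \<not> adjacent b d" using dist by (intro pair) auto
  have p3: "\<not> adjacent a d \<or> \<not> adjacent b c" using dist by (intro pair) auto
  have star: "adjacent w x \<or> adjacent w y \<or> adjacent w z"
    if "{x, y, z, w} = {a, b, c, d}" "distinct [x, y, z, w]" for w x y z
    using no_nonadjacent_star[of x y z w] that T by auto
  have triangle: "adjacent x y \<or> adjacent y z \<or> adjacent x z"
    if "{x, y, z} \<subseteq> {a, b, c, d}" "distinct [x, y, z]" for x y z
    using no_nonadjacent_triangle[of x y z] that T by auto
  have sa: "adjacent a b \<or> adjacent a c \<or> adjacent a d" using dist by (intro star) auto
  have sb: "adjacent b a \<or> adjacent b c \<or> adjacent b d" using dist by (intro star) auto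
  have sc: "adjacent c a \<or> adjacent c b \<or> adjacent c d" using dist by (intro star) auto
  have sd: "adjacent d a \<or> adjacent d b \<or> adjacent d c" using dist by (intro star) auto
  have ta: "adjacent b c \<or> adjacent c d \<or> adjacent b d" using dist by (intro triangle) auto
  have tb: "adjacent a c \<or> adjacent c d \<or> adjacent a d" using dist by (intro triangle) auto
  have tc: "adjacent a b \<or> adjacent b d \<or> adjacent a d" using dist by (intro triangle) auto
  have td: "adjacent a b \<or> adjacent b c \<or> adjacent a c" using dist by (intro triangle) auto
  show False
    using p1 p2 p3 sa sb sc sd ta tb tc td
      adjacent_commute[of b a] adjacent_commute[of c a] adjacent_commute[of d a]
      adjacent_commute[of c b] adjacent_commute[of d b] adjacent_commute[of d c] by argo
qed

section \<open>Six negative faces and their boundaries\<close>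

lemma card_negative_faces: "card negative_faces = 6"
proof -
  have "card negative_faces \<noteq> 0"
    using negative_faces_nonempty finite_odd_faces by (simp add: negative_faces_def)
  moreover have "even (card negative_faces)" unfolding negative_faces_def by (rule even_card_odd_faces)
  then obtain k where "card negative_faces = 2 * k" by (elim evenE)
  ultimately show ?thesis
    using card_negative_faces_le card_negative_faces_neq_2 card_negative_faces_neq_4 by presburger
qed

text \<open>The three edges of a minimum join through \<open>e\<close> have at most six ends, which
  must cover all six negative faces; no end is left for another face.\<close>

lemma ends_negative_faces:
  assumes "e \<in> edges G"
  shows "ends D e \<subseteq> negative_faces"
proof -
  obtain J where J: "J \<subseteq> edges G" "e \<in> J" "card J = 3" "odd_faces J = negative_faces"
    using minimum_join_through_edge[OF assms] by blast
  have "negative_faces \<subseteq> (\<Union>e\<in>J. ends D e)" using odd_faces_subset_ends[OF J(1)] J(4) by simp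
  then have "negative_faces = (\<Union>e\<in>J. ends D e)"
    using card_join_ends_le[OF J(1,3)] card_negative_faces by (intro card_seteq) auto
  then show ?thesis using J(2) by blast
qed

lemma no_separated_negative_faces:
  assumes "d \<in> negative_faces" "A \<subseteq> negative_faces" "3 \<le> card A" "d \<notin> A" "\<And>x. x \<in> A \<Longrightarrow> \<not> adjacent d x"
  shows False
proof -
  obtain B where "B \<subseteq> A" "card B = 3" using obtain_subset_with_card_n[OF assms(3)] by blast
  then obtain a b c where B: "{a, b, c} \<subseteq> A" "a \<noteq> b" "b \<noteq> c" "a \<noteq> c" by (auto simp: card_3_iff)
  have "distinct [a, b, c, d]" using B assms(4) by auto
  then show False using no_nonadjacent_star[of a b c d] B assms by auto
qed

text \<open>
  A proper subcycle of the boundary of F would be the boundary of a set S of faces all of whose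
  neighbours outside S equal F; then S and the faces outside S other than F are nonadjacent, and one
  of these two sets has at least three elements.
\<close>

lemma bd_negative_face_cycle:
  assumes F: "F \<in> negative_faces"
  shows "is_cycle G (bd {F})"
proof -
  let ?T = negative_faces
  have finT: "finite ?T" unfolding negative_faces_def by (rule finite_odd_faces)
  have "odd (card (bd {F} \<inter> {e. \<sigma> e = Negative}))"
    using F by (simp add: negative_faces_def odd_faces_def)
  then obtain C where C: "C \<subseteq> bd {F}" "is_cycle G C" "odd (card (C \<inter> {e. \<sigma> e = Negative}))"
    using odd_cycle_in_even_set[OF bd_subset even_in_cuts_dual_cut] by blast
  obtain S0 where S0: "C = bd S0" using cycle_is_dual_cut[OF C(2)] by blast
  \<comment> \<open>Both sides of every edge are negative, so a boundary does not change when the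
    set is restricted to \<open>?T\<close> or replaced by its complement in \<open>?T\<close>. One
    of the two choices avoids \<open>F\<close>.\<close>
  have "bd (S0 \<inter> ?T) = C" "bd (?T - S0) = C"
    unfolding S0 edge_cut_def using ends_negative_faces by blast+
  then obtain S where S: "S \<subseteq> ?T" "F \<notin> S" "C = bd S" by (cases "F \<in> S0") blast+
  have finS: "finite S" using S(1) finT finite_subset by blast
  have "S \<inter> odd_faces {e. \<sigma> e = Negative} = S" using S(1) by (auto simp: negative_faces_def)
  then have oddS: "odd (card S)" using odd_card_bd_Int[OF finS] C(3) S(3) by simp
  let ?R = "?T - insert F S"
  have cards: "card S + card ?R = 5"
  proof -
    have "card (insert F S) \<le> card ?T" using S(1) F finT by (intro card_mono) auto
    moreover have "card ?R = card ?T - card (insert F S)" using S(1) F finS by (intro card_Diff_subset) auto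
    ultimately show ?thesis using S(2) finS card_negative_faces by simp
  qed
  have sep: "\<not> adjacent x y" if xy: "x \<in> S" "y \<in> ?R" for x y
  proof
    assume "adjacent x y"
    then obtain e where e: "e \<in> edges G" "ends D e = {x, y}" by (auto simp: adjacent_def)
    then have "e \<in> bd S" using xy by (auto simp: edge_cut_def)
    then have "F \<in> ends D e" using C(1) S(3) by (auto simp: bd_singleton)
    then show False using e(2) xy S(2) by auto
  qed
  have "bd {F} \<subseteq> C"
  proof
    fix z assume z: "z \<in> bd {F}"
    show "z \<in> C"
    proof (rule ccontr)
      assume "z \<notin> C"
      have zE: "z \<in> edges G" "F \<in> ends D z" using z by (auto simp: bd_singleton)
      obtain w where w: "w \<in> ends D z" "w \<noteq> F" by (rule dual_ends[OF zE(1)]) auto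
      have "w \<notin> S" using \<open>z \<notin> C\<close> S(2,3) zE w by (auto simp: edge_cut_def)
      then have wR: "w \<in> ?R" using ends_negative_faces[OF zE(1)] w by auto
      \<comment> \<open>Both \<open>S\<close> and \<open>?R\<close> are nonempty: \<open>S\<close>
        has odd size, and \<open>w\<close> is in \<open>?R\<close>. Thus a side with three faces is
        always opposed by a face that is adjacent to none of them.\<close>
      have "card S \<noteq> 0" using oddS by (intro notI) simp
      then obtain x where x: "x \<in> S" using finS by fastforce
      have "3 \<le> card S \<or> 3 \<le> card ?R" using cards by linarith
      then show False
      proof
        assume "3 \<le> card S"
        then show False
          using wR S(1) sep adjacent_commute by (intro no_separated_negative_faces[of w S]) auto
      next
        assume "3 \<le> card ?R"
        then show False
          using x S(1) sep by (intro no_separated_negative_faces[of x ?R]) auto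
      qed
    qed
  qed
  then show ?thesis using C by (simp add: subset_antisym)
qed

text \<open>If \<open>F\<close> and \<open>F'\<close> had the same boundary, \<open>F\<close> would
  be adjacent to \<open>F'\<close> only, and the other four negative faces would be separated from
  it.\<close>

lemma inj_on_bd_negative_faces: "inj_on (\<lambda>F. bd {F}) negative_faces"
proof (rule inj_onI, rule ccontr)
  fix F F' assume F: "F \<in> negative_faces" "F' \<in> negative_faces" "bd {F} = bd {F'}" "F \<noteq> F'"
  have "\<not> adjacent F x" if x: "x \<in> negative_faces - {F, F'}" for x
  proof
    assume "adjacent F x"
    then obtain e where e: "e \<in> edges G" "ends D e = {F, x}" by (auto simp: adjacent_def)
    then have "e \<in> bd {F'}" unfolding F(3)[symmetric] by (simp add: bd_singleton)
    then show False using e(2) x F(4) by (auto simp: bd_singleton)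
  qed
  moreover have "card (negative_faces - {F, F'}) = 4"
    using F card_negative_faces by (subst card_Diff_subset) auto
  ultimately show False
    using no_separated_negative_faces[of F "negative_faces - {F, F'}"] F(1) by auto
qed

lemma bd_empty_if_not_negative_face:
  assumes "F \<notin> negative_faces"
  shows "bd {F} = {}"
  using ends_negative_faces assms by (auto simp: bd_singleton)

end

section \<open>Facial cycles of the plane graph\<close>

theorem mainTheorem3:
  fixes G :: "('v, 'e) multigraph"
    and \<sigma> :: "'e \<Rightarrow> edge_sign"
    and p :: "'v \<Rightarrow> complex"
    and \<gamma> :: "'e \<Rightarrow> real \<Rightarrow> complex"
  assumes "signed_plane_graph G \<sigma> p \<gamma>"
    and "non_decomposable_critically_frustrated 3 G \<sigma>"
  shows "card {C. facial_cycle G p \<gamma> C} = 6 \<and>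
    (\<forall>C. facial_cycle G p \<gamma> C \<longrightarrow> negative_cycle G \<sigma> C)"
proof -
  have crit: "critically_frustrated 3 G \<sigma>" "\<not> decomposable 3 G \<sigma>"
    using assms(2) by (auto simp: non_decomposable_critically_frustrated_def)
  interpret plane_graph G p \<gamma>
    using assms(1) by unfold_locales (auto simp: signed_plane_graph_def signed_graph_def)
  interpret bridgeless_plane_graph G p \<gamma>
  proof
    show "\<exists>C. is_cycle G C \<and> e \<in> C" if "e \<in> edges G" for e
      using crit(1) that by (intro critical_edge_in_cycle[of \<sigma> 2]) (auto simp: critically_frustrated_iff)
  qed
  interpret dual: critical_dual_pair G dual \<sigma>
    using crit cycle_is_dual_cut even_in_cuts_dual_cut by unfold_locales auto
  have facial: "facial_cycle G p \<gamma> C \<longleftrightarrow> (\<exists>F\<in>dual.negative_faces. C = edge_cut dual (edges G) {F})" for C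
  proof
    assume "facial_cycle G p \<gamma> C"
    then obtain F where F: "is_cycle G C" "F \<in> faces G p \<gamma>" "C = edge_cut dual (edges G) {F}"
      using boundary_edges_eq by (auto simp: facial_cycle_def)
    then have "F \<in> dual.negative_faces"
      using dual.bd_empty_if_not_negative_face is_cycle_nonempty by blast
    then show "\<exists>F\<in>dual.negative_faces. C = edge_cut dual (edges G) {F}" using F by blast
  next
    assume "\<exists>F\<in>dual.negative_faces. C = edge_cut dual (edges G) {F}"
    then obtain F where F: "F \<in> dual.negative_faces" "C = edge_cut dual (edges G) {F}" by blast
    then have cyc: "is_cycle G C" using dual.bd_negative_face_cycle by simp
    then obtain e where "e \<in> C" using is_cycle_nonempty by blast
    \<comment> \<open>\<open>negative_faces\<close> ranges over arbitrary sets of points; an edge in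
      the boundary shows that \<open>F\<close> is a face.\<close>
    then have "F \<in> faces G p \<gamma>" using F(2) sides_faces by (auto simp: edge_cut_def)
    then show "facial_cycle G p \<gamma> C" using cyc F(2) boundary_edges_eq by (auto simp: facial_cycle_def)
  qed
  have "{C. facial_cycle G p \<gamma> C} = (\<lambda>F. edge_cut dual (edges G) {F}) ` dual.negative_faces"
    using facial by blast
  then have "card {C. facial_cycle G p \<gamma> C} = 6"
    using card_image[OF dual.inj_on_bd_negative_faces] dual.card_negative_faces by simp
  moreover have "negative_cycle G \<sigma> C" if C: "facial_cycle G p \<gamma> C" for C
  proof -
    obtain F where "F \<in> dual.negative_faces" "C = edge_cut dual (edges G) {F}" using C facial by blast
    then have "odd_set \<sigma> C" using dual.odd_set_bd_negative_face by simp
    then show ?thesis using C by (auto simp: negative_cycle_def facial_cycle_def odd_set_def)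
  qed
  ultimately show ?thesis by blast
qed

end
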